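(* Let $g:\mathbb{R}^m\to\mathbb{R}^k$ be a smooth function with Jacobian $G(q)\in\mathbb{R}^{k\times m}$, and suppose that $M=\{q\in\mathbb{R}^m: g(q)=0\}$ is a connected manifold such that $G(q)$ has full rank for every $q\in M$. Let $U:\mathbb{R}^m\to\mathbb{R}$ be smooth, let $H(q,p)=U(q)+\frac12 p^\top p$, and let $\mathrm{L}\in\mathbb{R}^{m\times m}$ be skew-symmetric. Let $\mathrm{T}^*M\subset\mathbb{R}^{2m}$ be the embedded cotangent bundle, $\Omega_{\mathrm{mag}}$ the magnetic symplectic structure, and $\Phi_{\mathrm{mag}}(\cdot,\cdot;t):\mathrm{T}^*M\to\mathrm{T}^*M$ the magnetic vector field flow to time $t$ (all defined in the context). Then: (i) $\Phi_{\mathrm{mag}}$ is symmetric: $\Phi_{\mathrm{mag}}(\Phi_{\mathrm{mag}}(q,p;t);-t)=(q,p)$ for $(q,p)\in\mathrm{T}^*M$. (ii) $\Phi_{\mathrm{mag}}(\cdot,\cdot;t)$ is a symplectic transformation of $\mathrm{T}^*M$: $\Phi_{\mathrm{mag}}^*\Omega_{\mathrm{mag}}=\Omega_{\mathrm{mag}}$. (iii) $\Phi_{\mathrm{mag}}(\cdot,\cdot;t)$ conserves the Hamiltonian: $H(\Phi_{\mathrm{mag}}(q,p;t))=H(q,p)$ for every $(q,p)\in\mathrm{T}^*M$.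
   Context: Embedded cotangent bundle: $\mathrm{T}^*M=\{(q,p)\in\mathbb{R}^{2m}: g(q)=0,\ G(q)\nabla_pH(q,p)=0\}$; for $H(q,p)=U(q)+\frac12p^\top p$ the second condition is $G(q)p=0$. It is an embedded submanifold of $\mathbb{R}^{2m}$, and tangent vectors to it are regarded as vectors in $\mathbb{R}^{2m}$. Magnetic symplectic structure: $\Omega_{\mathrm{mag}}(u,v)=u^\top\mathbb{J}_{\mathrm{mag}}v$ with $\mathbb{J}_{\mathrm{mag}}=\begin{pmatrix}\mathrm{L}&\mathrm{Id}_m\\-\mathrm{Id}_m&\mathbf{0}_m\end{pmatrix}$, applied to tangent vectors $u,v\in\mathrm{T}_{(q,p)}\mathrm{T}^*M\subset\mathbb{R}^{2m}$. Pullback: for a smooth map $\Phi$ of $\mathrm{T}^*M$, $(\Phi^*\Omega)(u,v)=\Omega((\mathrm{T}_z\Phi)u,(\mathrm{T}_z\Phi)v)$ for $u,v\in \mathrm{T}_z\mathrm{T}^*M$, where $\mathrm{T}_z\Phi$ is the differential of $\Phi$ at $z$. Magnetic vector field flow: $(q_t,p_t)=\Phi_{\mathrm{mag}}(q,p;t)$ is the solution at time $t$, starting from $(q_0,p_0)=(q,p)\in\mathrm{T}^*M$, of $$\dot q_t=\nabla_pH(q_t,p_t),\qquad \dot p_t=-\nabla_qH(q_t,p_t)-\mathrm{L}\nabla_pH(q_t,p_t)-G(q_t)^\top\lambda,\qquad g(q_t)=0,$$ where $\lambda=\lambda(q_t,p_t)\in\mathbb{R}^k$ is the vector of Lagrange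 multipliers, uniquely determined by the requirement $g(q_t)=0$ along the solution. If the flow is not complete, all identities are understood wherever the flow is defined. *)

theory Defs
  imports "HOL-Analysis.Analysis"
begin

(* On a Euclidean space a map is n-times continuously differentiable iff it is differentiable and
   all its directional derivatives are (n-1)-times continuously differentiable. *)
primrec times_cont_diff ::
    "nat \<Rightarrow> ('a::euclidean_space \<Rightarrow> 'b::real_normed_vector) \<Rightarrow> bool" where
  "times_cont_diff 0 f \<longleftrightarrow> continuous_on UNIV f"
| "times_cont_diff (Suc n) f \<longleftrightarrow> (\<forall>x. f differentiable (at x)) \<and>
     (\<forall>v. times_cont_diff n (\<lambda>x. frechet_derivative f (at x) v))"

definition smooth :: "('a::euclidean_space \<Rightarrow> 'b::real_normed_vector) \<Rightarrow> bool" where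
  "smooth f \<longleftrightarrow> (\<forall>n. times_cont_diff n f)"

definition grad :: "('a::euclidean_space \<Rightarrow> real) \<Rightarrow> 'a \<Rightarrow> 'a" where
  "grad f x = (THE D. GDERIV f x :> D)"

definition grad_q :: "((real^'m) \<times> (real^'m) \<Rightarrow> real) \<Rightarrow> (real^'m) \<times> (real^'m) \<Rightarrow> real^'m" where
  "grad_q H z = grad (\<lambda>q. H (q, snd z)) (fst z)"

definition grad_p :: "((real^'m) \<times> (real^'m) \<Rightarrow> real) \<Rightarrow> (real^'m) \<times> (real^'m) \<Rightarrow> real^'m" where
  "grad_p H z = grad (\<lambda>p. H (fst z, p)) (snd z)"

definition hamiltonian :: "(real^'m \<Rightarrow> real) \<Rightarrow> (real^'m) \<times> (real^'m) \<Rightarrow> real" where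
  "hamiltonian U = (\<lambda>(q, p). U q + 1/2 * (p \<bullet> p))"

abbreviation Jac :: "(real^'m \<Rightarrow> real^'k) \<Rightarrow> real^'m \<Rightarrow> real^'m^'k" where
  "Jac g q \<equiv> jacobian g (at q)"

definition cotangent_bundle ::
    "((real^'m) \<times> (real^'m) \<Rightarrow> real) \<Rightarrow> (real^'m \<Rightarrow> real^'k) \<Rightarrow> ((real^'m) \<times> (real^'m)) set" where
  "cotangent_bundle H g = {(q, p). g q = 0 \<and> Jac g q *v grad_p H (q, p) = 0}"

(* For an embedded submanifold S, differentiability of c at 0 alone yields the same velocities as
   smoothness of c would. *)
definition tangent_space :: "'a::real_normed_vector set \<Rightarrow> 'a \<Rightarrow> 'a set" where
  "tangent_space S z = {u. \<exists>c e. e > 0 \<and> (\<forall>s\<in>{-e<..<e}. c s \<in> S) \<and> c 0 = z \<and>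
     (c has_vector_derivative u) (at (0::real))}"

(* Pullback of a bilinear form by a map on the embedded submanifold S.  Where the map is
   differentiable at z within S, its derivative there is determined on the tangent space of S at z
   but not in normal directions; the value is meant for u, v in the tangent space only. *)
definition pullback_form ::
    "'a::real_normed_vector set \<Rightarrow> ('a \<Rightarrow> 'b::real_normed_vector) \<Rightarrow> ('b \<Rightarrow> 'b \<Rightarrow> real) \<Rightarrow>
     'a \<Rightarrow> 'a \<Rightarrow> 'a \<Rightarrow> real" where
  "pullback_form S \<Phi> \<omega> z u v =
     \<omega> (frechet_derivative \<Phi> (at z within S) u) (frechet_derivative \<Phi> (at z within S) v)"

(* Action of the block matrix with rows (L, Id) and (-Id, 0). *)
definition J_mag :: "real^'m^'m \<Rightarrow> (real^'m) \<times> (real^'m) \<Rightarrow> (real^'m) \<times> (real^'m)" where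
  "J_mag L = (\<lambda>(v1, v2). (L *v v1 + v2, - v1))"

definition Omega_mag :: "real^'m^'m \<Rightarrow> (real^'m) \<times> (real^'m) \<Rightarrow> (real^'m) \<times> (real^'m) \<Rightarrow> real" where
  "Omega_mag L u v = u \<bullet> J_mag L v"

definition mag_solution ::
    "((real^'m) \<times> (real^'m) \<Rightarrow> real) \<Rightarrow> (real^'m \<Rightarrow> real^'k) \<Rightarrow> real^'m^'m \<Rightarrow>
     real set \<Rightarrow> (real \<Rightarrow> real^'m) \<Rightarrow> (real \<Rightarrow> real^'m) \<Rightarrow> bool" where
  "mag_solution H g L I q p \<longleftrightarrow> (\<exists>lam :: (real^'m) \<times> (real^'m) \<Rightarrow> real^'k. \<forall>t\<in>I.
     (q has_vector_derivative grad_p H (q t, p t)) (at t) \<and>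
     (p has_vector_derivative
        (- grad_q H (q t, p t) - L *v grad_p H (q t, p t)
         - transpose (Jac g (q t)) *v lam (q t, p t))) (at t) \<and>
     g (q t) = 0)"

(* Some solution starting at z exists up to time t (which may be negative) and is at w there. *)
definition mag_reaches ::
    "((real^'m) \<times> (real^'m) \<Rightarrow> real) \<Rightarrow> (real^'m \<Rightarrow> real^'k) \<Rightarrow> real^'m^'m \<Rightarrow>
     real \<Rightarrow> (real^'m) \<times> (real^'m) \<Rightarrow> (real^'m) \<times> (real^'m) \<Rightarrow> bool" where
  "mag_reaches H g L t z w \<longleftrightarrow> (\<exists>I q p. open I \<and> is_interval I \<and> 0 \<in> I \<and> t \<in> I \<and>
     mag_solution H g L I q p \<and> (q 0, p 0) = z \<and> (q t, p t) = w)"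

definition mag_flow_dom ::
    "((real^'m) \<times> (real^'m) \<Rightarrow> real) \<Rightarrow> (real^'m \<Rightarrow> real^'k) \<Rightarrow> real^'m^'m \<Rightarrow>
     real \<Rightarrow> ((real^'m) \<times> (real^'m)) set" where
  "mag_flow_dom H g L t = {z \<in> cotangent_bundle H g. \<exists>w. mag_reaches H g L t z w}"

definition mag_flow ::
    "((real^'m) \<times> (real^'m) \<Rightarrow> real) \<Rightarrow> (real^'m \<Rightarrow> real^'k) \<Rightarrow> real^'m^'m \<Rightarrow>
     real \<Rightarrow> (real^'m) \<times> (real^'m) \<Rightarrow> (real^'m) \<times> (real^'m)" where
  "mag_flow H g L t z = (THE w. mag_reaches H g L t z w)"

end

(* On the constraint manifold G G^T is invertible, so differentiating g (q t) = 0 twice determines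
   the multiplier; Cramer's rule extends it to a C^1 function on an open set, and the constrained
   system becomes an ordinary differential equation z' = X z whose flow preserves the cotangent
   bundle. Uniqueness for this equation gives (i), and H is constant because skewness of L and
   G p = 0 cancel the remaining terms. For (ii), nearby solutions exist on the same interval and
   depend differentiably on the initial value, the derivative eta solving the variational equation.
   For tangent initial vectors eta stays tangent, so the terms containing the multiplier's derivative
   drop out and symmetry of the second derivatives of U and g makes Omega_mag (eta u) (eta v)
   constant in time. *)

theory Submission
  imports Defs
begin

subsection \<open>Ordinary differential equations and dependence on initial values\<close>

text \<open>The obstacle is that the flow acts on a lower-dimensional set, where a derivative within
  the set is pinned down only along tangent vectors. Extending the multiplier off the bundle gives
  access to an open set: every nearby initial value has a solution, the field can be linearised in
  all directions, and only then is the result restricted to the bundle. The derivative chosen by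
  \<open>frechet_derivative\<close> within the bundle need not be the variational one; the two are
  compared along curves in the bundle, which suffices because the pullback is evaluated at tangent
  vectors only. Of tangency only the position part, G(q) applied to the position component being
  zero, enters the symplectic computation, and it persists because g vanishes along all nearby
  solutions in the bundle. Since t may be negative, all estimates are made on intervals containing 0
  rather than starting there.\<close>

lemma continuous_on_solution:
  fixes x :: "real \<Rightarrow> 'a::real_normed_vector"
  assumes "\<And>s. s \<in> S \<Longrightarrow> (x has_vector_derivative x' s) (at s within S)"
  shows "continuous_on S x"
  using assms
  by (intro has_derivative_continuous_on[where f' = "\<lambda>t h. h *\<^sub>R x' t"])
    (auto simp: has_vector_derivative_def)

lemma zero_vector_derivative_eq:
  fixes f :: "real \<Rightarrow> 'a::real_normed_vector"
  assumes "\<And>s. s \<in> {a..b} \<Longrightarrow> (f has_vector_derivative 0) (at s within {a..b})"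
    and "s \<in> {a..b}" "t \<in> {a..b}"
  shows "f s = f t"
proof (rule has_vector_derivative_zero_constant[of "{a..b}" f])
  fix c assume "\<And>x. x \<in> {a..b} \<Longrightarrow> f x = c"
  then show ?thesis using assms(2,3) by simp
qed (use assms(1) in auto)

section \<open>Gronwall estimates by an exponential weight\<close>

lemma exp_weight_estimate_pos:
  fixes x :: "real \<Rightarrow> 'a::real_normed_vector"
  assumes deriv: "\<And>s. s \<in> {0..b} \<Longrightarrow> (x has_vector_derivative x' s) (at s within {0..b})"
    and bnd: "\<And>s. s \<in> {0..b} \<Longrightarrow> norm (x' s) \<le> K * m * exp (2 * K * s) + e"
    and K: "K > 0" and s: "s \<in> {0..b}"
  shows "norm (x s - x 0) \<le> m / 2 * (exp (2 * K * s) - 1) + e * s"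
proof (cases "s = 0")
  case False
  with s have "0 < s" by auto
  have cont: "continuous_on {0..b} x" by (rule continuous_on_solution[OF deriv])
  \<comment> \<open>An antiderivative of the bound on \<open>x'\<close>. The exponent
    \<open>2 * K\<close>, against the factor \<open>K\<close> in front, produces the coefficient
    \<open>m / 2\<close>: this one half later absorbs a term in Gronwall's inequality and is the
    contraction factor of the Picard operator.\<close>
  let ?\<phi> = "\<lambda>s. m / 2 * exp (2 * K * s) + e * s"
  have "norm (x s - x 0) \<le> ?\<phi> s - ?\<phi> 0"
  proof (rule differentiable_bound_general[OF \<open>0 < s\<close>, where f' = x' and \<phi>' = "\<lambda>s. K * m * exp (2 * K * s) + e"])
    show "continuous_on {0..s} x"
      using cont s by (auto intro: continuous_on_subset)
    show "continuous_on {0..s} ?\<phi>" by (intro continuous_intros)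
    fix t assume t: "0 < t" "t < s"
    then have "(x has_vector_derivative x' t) (at t within {0..b})" using deriv s by auto
    then show "(x has_vector_derivative x' t) (at t)"
      using t s at_within_Icc_at[of 0 t b] by auto
    show "(?\<phi> has_vector_derivative K * m * exp (2 * K * t) + e) (at t)"
      unfolding has_real_derivative_iff_has_vector_derivative[symmetric]
      by (auto intro!: derivative_eq_intros)
    show "norm (x' t) \<le> K * m * exp (2 * K * t) + e" using bnd t s by auto
  qed
  then show ?thesis by (simp add: algebra_simps)
qed simp

text \<open>Backward times reduce to forward ones by the reflection of s to -s, which is why the
  weight contains \<open>\<bar>s\<bar>\<close>.\<close>

lemma exp_weight_estimate:
  fixes x :: "real \<Rightarrow> 'a::real_normed_vector"
  assumes ab: "a \<le> 0" "0 \<le> b"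
    and deriv: "\<And>s. s \<in> {a..b} \<Longrightarrow> (x has_vector_derivative x' s) (at s within {a..b})"
    and bnd: "\<And>s. s \<in> {a..b} \<Longrightarrow> norm (x' s) \<le> K * m * exp (2 * K * \<bar>s\<bar>) + e"
    and K: "K > 0" and s: "s \<in> {a..b}"
  shows "norm (x s - x 0) \<le> m / 2 * (exp (2 * K * \<bar>s\<bar>) - 1) + e * \<bar>s\<bar>"
proof (cases "0 \<le> s")
  case True
  have "norm (x s - x 0) \<le> m / 2 * (exp (2 * K * s) - 1) + e * s"
  proof (rule exp_weight_estimate_pos[where b = b and x' = x'])
    fix t assume "t \<in> {0..b}"
    then show "(x has_vector_derivative x' t) (at t within {0..b})"
      using ab by (intro has_vector_derivative_within_subset[OF deriv]) auto
    show "norm (x' t) \<le> K * m * exp (2 * K * t) + e"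
      using bnd[of t] \<open>t \<in> _\<close> ab by auto
  qed (use K s True in auto)
  then show ?thesis using True by simp
next
  case False
  have "norm ((x \<circ> uminus) (- s) - (x \<circ> uminus) 0) \<le> m / 2 * (exp (2 * K * (- s)) - 1) + e * (- s)"
  proof (rule exp_weight_estimate_pos[where b = "- a" and x' = "\<lambda>t. (- 1) *\<^sub>R x' (- t)"])
    fix t assume t: "t \<in> {0..-a}"
    have *: "(x has_vector_derivative x' (- t)) (at (- t) within uminus ` {0..-a})"
      using t ab by (intro has_vector_derivative_within_subset[OF deriv]) auto
    show "(x \<circ> uminus has_vector_derivative (- 1) *\<^sub>R x' (- t)) (at t within {0..-a})"
      by (rule vector_diff_chain_within[OF _ *]) (auto intro!: derivative_eq_intros)
    show "norm ((- 1) *\<^sub>R x' (- t)) \<le> K * m * exp (2 * K * t) + e"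
      using bnd[of "- t"] t ab by auto
  qed (use K s False in auto)
  then show ?thesis using False by simp
qed

text \<open>Let m be the maximum of the norm weighted by
  \<open>exp (- 2 * K * \<bar>s\<bar>)\<close>, attained at r. Integrating the bound on
  \<open>x'\<close> from 0 to r returns at most half of the weighted maximum, which is absorbed on
  the left; this bounds m by the initial value and the error. The constant is not sharp, but it is
  uniform over the interval, since \<open>\<bar>s\<bar> \<le> b - a\<close>.\<close>

lemma gronwall:
  fixes x :: "real \<Rightarrow> 'a::real_normed_vector"
  assumes ab: "a \<le> 0" "0 \<le> b"
    and deriv: "\<And>s. s \<in> {a..b} \<Longrightarrow> (x has_vector_derivative x' s) (at s within {a..b})"
    and bnd: "\<And>s. s \<in> {a..b} \<Longrightarrow> norm (x' s) \<le> K * norm (x s) + e"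
    and K: "K > 0" and e: "e \<ge> 0" and s: "s \<in> {a..b}"
  shows "norm (x s) \<le> 2 * (norm (x 0) + e * (b - a)) * exp (2 * K * (b - a))"
proof -
  let ?w = "\<lambda>s. exp (- (2 * K * \<bar>s\<bar>)) * norm (x s)"
  have "continuous_on {a..b} ?w"
    using continuous_on_solution[of "{a..b}" x x'] deriv by (intro continuous_intros) auto
  then obtain r where r: "r \<in> {a..b}" "\<And>t. t \<in> {a..b} \<Longrightarrow> ?w t \<le> ?w r"
    using continuous_attains_sup[of "{a..b}" ?w] ab by auto
  define m where "m = ?w r"
  have m0: "m \<ge> 0" by (simp add: m_def)
  have wm: "norm (x t) \<le> m * exp (2 * K * \<bar>t\<bar>)" if "t \<in> {a..b}" for t
    using r(2)[OF that] unfolding m_def[symmetric] by (simp add: exp_minus field_simps)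
  have est: "norm (x r - x 0) \<le> m / 2 * (exp (2 * K * \<bar>r\<bar>) - 1) + e * \<bar>r\<bar>"
  proof (rule exp_weight_estimate[OF ab deriv _ K r(1)])
    fix t assume t: "t \<in> {a..b}"
    have "K * norm (x t) \<le> K * (m * exp (2 * K * \<bar>t\<bar>))"
      using K by (intro mult_left_mono wm[OF t]) auto
    then show "norm (x' t) \<le> K * m * exp (2 * K * \<bar>t\<bar>) + e"
      using bnd[OF t] unfolding mult.assoc[of K m] by linarith
  qed
  have rab: "\<bar>r\<bar> \<le> b - a" using r(1) ab by auto
  have "norm (x r) = m * exp (2 * K * \<bar>r\<bar>)" by (simp add: m_def exp_minus)
  moreover have "norm (x r) \<le> norm (x 0) + norm (x r - x 0)" by norm
  ultimately have "m * exp (2 * K * \<bar>r\<bar>) \<le> norm (x 0) + (m / 2 * (exp (2 * K * \<bar>r\<bar>) - 1) + e * \<bar>r\<bar>)"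
    using est by linarith
  then have "m / 2 * exp (2 * K * \<bar>r\<bar>) \<le> norm (x 0) + e * \<bar>r\<bar>" using m0 by (simp add: algebra_simps)
  moreover have "m / 2 * 1 \<le> m / 2 * exp (2 * K * \<bar>r\<bar>)" using m0 K by (intro mult_left_mono) auto
  moreover have "e * \<bar>r\<bar> \<le> e * (b - a)" using e rab by (intro mult_left_mono) auto
  ultimately have m: "m \<le> 2 * (norm (x 0) + e * (b - a))" by (simp add: algebra_simps)
  have "norm (x s) \<le> m * exp (2 * K * \<bar>s\<bar>)" by (rule wm[OF s])
  also have "\<dots> \<le> m * exp (2 * K * (b - a))"
    using m0 K s ab by (intro mult_left_mono) (auto simp: abs_if)
  also have "\<dots> \<le> 2 * (norm (x 0) + e * (b - a)) * exp (2 * K * (b - a))"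
    using m by (intro mult_right_mono) auto
  finally show ?thesis .
qed

section \<open>Picard iteration on a compact interval\<close>

lemma clamp_interval:
  fixes a b s :: real
  assumes "a \<le> b"
  shows "clamp a b s \<in> {a..b}" and "s \<in> {a..b} \<Longrightarrow> clamp a b s = s"
  using clamp_in_interval[of a b s] clamp_cancel_cbox[of s a b] assms by auto

text \<open>The Picard operator is a contraction for the sup norm weighted by \<open>exp (- 2 * K * \<bar>s\<bar>)\<close>,
  uniformly in the length of the interval; \<open>w\<close> below stands for the weighted solution.\<close>

lemma integral_equation_solvable:
  fixes F :: "real \<Rightarrow> 'a::euclidean_space \<Rightarrow> 'a"
  assumes ab: "a \<le> 0" "0 \<le> b" and K: "K > 0"
    and cont: "\<And>x. continuous_on {a..b} x \<Longrightarrow> continuous_on {a..b} (\<lambda>s. F s (x s))"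
    and lip: "\<And>s x y. s \<in> {a..b} \<Longrightarrow> norm (F s x - F s y) \<le> K * norm (x - y)"
  obtains x where "continuous_on {a..b} x"
    "\<And>s. s \<in> {a..b} \<Longrightarrow>
       x s = y + (integral {a..s} (\<lambda>r. F r (x r)) - integral {a..0} (\<lambda>r. F r (x r)))"
proof -
  define e where "e s = exp (2 * K * \<bar>s\<bar>)" for s :: real
  have e_pos: "e s > 0" for s by (simp add: e_def)
  have e_cont: "continuous_on S e" for S unfolding e_def by (intro continuous_intros)
  define f where "f w r = F r (e r *\<^sub>R w r)" for w r
  have f_cont: "continuous_on {a..b} (f w)" if "continuous_on {a..b} w" for w
    unfolding f_def by (rule cont) (intro continuous_intros e_cont that)
  \<comment> \<open>The integral from 0 to s with orientation, written as a difference of integrals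
    from a so that it is correct for negative s too.\<close>
  define J where "J w s = integral {a..s} (f w) - integral {a..0} (f w)" for w s
  have J_deriv: "(J w has_vector_derivative f w s) (at s within {a..b})"
    if "continuous_on {a..b} w" "s \<in> {a..b}" for w s
    unfolding J_def using integral_has_vector_derivative[OF f_cont[OF that(1)] that(2)]
    by (auto intro!: derivative_eq_intros)
  have J_cont: "continuous_on {a..b} (J w)" if "continuous_on {a..b} w" for w
    by (rule continuous_on_solution[OF J_deriv[OF that]])
  \<comment> \<open>The Picard operator conjugated with multiplication by \<open>e\<close>: the
    ordinary sup norm of \<open>w\<close> is the weighted sup norm of \<open>e\<close> times
    \<open>w\<close>.\<close>
  define P where "P w s = inverse (e s) *\<^sub>R (y + J w s)" for w s
  have P_cont: "continuous_on {a..b} (P w)" if "continuous_on {a..b} w" for w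
    unfolding P_def using e_pos less_imp_neq[OF e_pos]
    by (intro continuous_intros e_cont J_cont that) auto
  \<comment> \<open>Banach's theorem is applied in the complete space of bounded continuous
    functions on the whole line; clamping the argument extends a function on \<open>{a..b}\<close>
    by its boundary values.\<close>
  have "\<exists>W. \<forall>s. apply_bcontfun W s = P w (clamp a b s)"
    if "continuous_on {a..b} w" for w :: "real \<Rightarrow> 'a"
    using continuous_on_cbox_bcontfunE[of a b "P w"] P_cont[OF that] by (metis cbox_interval)
  then have "\<exists>W. \<forall>s. apply_bcontfun W s = P (apply_bcontfun w) (clamp a b s)"
    for w :: "real \<Rightarrow>\<^sub>C 'a" by simp
  then obtain T where T: "\<And>w s. apply_bcontfun (T w) s = P (apply_bcontfun w) (clamp a b s)"
    by metis
  have "dist (T v) (T w) \<le> 1 / 2 * dist v w" for v w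
  proof (rule dist_bound)
    fix s0 define s where "s = clamp a b s0"
    have s: "s \<in> {a..b}" using clamp_interval ab by (auto simp: s_def)
    let ?d = "\<lambda>s. J v s - J w s"
    have "norm (?d s - ?d 0) \<le> dist v w / 2 * (exp (2 * K * \<bar>s\<bar>) - 1) + 0 * \<bar>s\<bar>"
    proof (rule exp_weight_estimate[where x = ?d, OF ab _ _ K s])
      fix t assume t: "t \<in> {a..b}"
      show "(?d has_vector_derivative f v t - f w t) (at t within {a..b})"
        using t by (intro derivative_intros J_deriv) auto
      have "norm (f v t - f w t) \<le> K * norm (e t *\<^sub>R v t - e t *\<^sub>R w t)"
        unfolding f_def using lip t by auto
      also have "\<dots> = K * (e t * dist (v t) (w t))"
        by (simp add: scaleR_diff_right[symmetric] dist_norm e_pos less_imp_le)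
      also have "\<dots> \<le> K * (e t * dist v w)"
        using K e_pos[of t] by (intro mult_left_mono dist_bounded) auto
      finally show "norm (f v t - f w t) \<le> K * dist v w * exp (2 * K * \<bar>t\<bar>) + 0"
        by (simp add: e_def mult_ac)
    qed
    also have "?d 0 = 0" by (simp add: J_def)
    also have "dist v w / 2 * (exp (2 * K * \<bar>s\<bar>) - 1) + 0 * \<bar>s\<bar> \<le> dist v w / 2 * e s"
      by (simp add: e_def mult_left_mono)
    finally have d: "norm (J v s - J w s) \<le> dist v w / 2 * e s" by simp
    have "dist (T v s0) (T w s0) = inverse (e s) * norm (J v s - J w s)"
      by (simp add: T s_def[symmetric] P_def dist_norm scaleR_diff_right[symmetric] e_pos less_imp_le)
    also have "\<dots> \<le> inverse (e s) * (dist v w / 2 * e s)"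
      using e_pos[of s] d by (intro mult_left_mono) auto
    also have "\<dots> = 1 / 2 * dist v w" using e_pos[of s] by simp
    finally show "dist (T v s0) (T w s0) \<le> 1 / 2 * dist v w" .
  qed
  then obtain w where w: "T w = w"
    using banach_fix_type[of "1/2" T] by auto
  define x where "x s = e s *\<^sub>R w s" for s
  have fx: "f w r = F r (x r)" for r by (simp add: f_def x_def)
  have wP: "w s = P w s" if "s \<in> {a..b}" for s
    using T[of w s] w clamp_interval(2)[of a b s] that by auto
  show thesis
  proof
    show "continuous_on {a..b} x" unfolding x_def by (intro continuous_intros e_cont) auto
    fix s assume s: "s \<in> {a..b}"
    have "x s = e s *\<^sub>R P w s" using wP[OF s] by (simp add: x_def)
    also have "\<dots> = y + J w s" using e_pos[of s] by (simp add: P_def)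
    finally show "x s = y + (integral {a..s} (\<lambda>r. F r (x r)) - integral {a..0} (\<lambda>r. F r (x r)))"
      by (simp add: J_def fx[abs_def])
  qed
qed

text \<open>A Lipschitz constant valid on the whole space gives a solution on all of
  \<open>{a..b}\<close>, with no shrinking of the interval. Continuity is asked only along
  continuous curves, which is what the integrand needs.\<close>

lemma picard_global:
  fixes F :: "real \<Rightarrow> 'a::euclidean_space \<Rightarrow> 'a"
  assumes ab: "a \<le> 0" "0 \<le> b" and K: "K > 0"
    and cont: "\<And>x. continuous_on {a..b} x \<Longrightarrow> continuous_on {a..b} (\<lambda>s. F s (x s))"
    and lip: "\<And>s x y. s \<in> {a..b} \<Longrightarrow> norm (F s x - F s y) \<le> K * norm (x - y)"
  obtains x where "x 0 = y"
    "\<forall>s\<in>{a..b}. (x has_vector_derivative F s (x s)) (at s within {a..b})"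
proof -
  obtain x where x: "continuous_on {a..b} x" "\<And>s. s \<in> {a..b} \<Longrightarrow>
       x s = y + (integral {a..s} (\<lambda>r. F r (x r)) - integral {a..0} (\<lambda>r. F r (x r)))"
    using integral_equation_solvable[OF ab K cont lip] by blast
  show thesis
  proof
    show "x 0 = y" using x(2)[of 0] ab by auto
    show "\<forall>s\<in>{a..b}. (x has_vector_derivative F s (x s)) (at s within {a..b})"
    proof
      fix s assume s: "s \<in> {a..b}"
      have "((\<lambda>s. y + (integral {a..s} (\<lambda>r. F r (x r)) - integral {a..0} (\<lambda>r. F r (x r))))
          has_vector_derivative F s (x s)) (at s within {a..b})"
        using integral_has_vector_derivative[OF cont[OF x(1)] s]
        by (auto intro!: derivative_eq_intros)
      then show "(x has_vector_derivative F s (x s)) (at s within {a..b})"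
        by (rule has_vector_derivative_transform[OF s, rotated]) (rule x(2))
    qed
  qed
qed

section \<open>Existence, uniqueness and differentiable dependence near a fixed solution\<close>

locale reference_solution =
  fixes X :: "'a::euclidean_space \<Rightarrow> 'a" and X' :: "'a \<Rightarrow> 'a \<Rightarrow>\<^sub>L 'a"
    and W :: "'a set" and a b :: real and z :: "real \<Rightarrow> 'a"
  assumes W: "open W" and ab: "a \<le> 0" "0 \<le> b"
    and X_deriv: "\<And>x. x \<in> W \<Longrightarrow> (X has_derivative X' x) (at x)"
    and X'_cont: "continuous_on W X'"
    and z_deriv: "\<And>s. s \<in> {a..b} \<Longrightarrow> (z has_vector_derivative X (z s)) (at s within {a..b})"
    and z_in: "\<And>s. s \<in> {a..b} \<Longrightarrow> z s \<in> W"
begin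

lemma z_cont: "continuous_on {a..b} z"
  by (rule continuous_on_solution[OF z_deriv])

text \<open>Compactness of the curve gives a compact neighbourhood \<open>N\<close> inside
  \<open>W\<close>. Boundedness of \<open>X'\<close> on \<open>N\<close> yields one Lipschitz
  constant, and uniform continuity of \<open>X'\<close> on \<open>N\<close> yields a first-order
  remainder uniform in time. Both mean value estimates are made inside single balls, because
  \<open>N\<close> need not be convex.\<close>

lemma tube:
  obtains \<delta> K where "\<delta> > 0" "K > 0"
    "\<forall>s\<in>{a..b}. cball (z s) \<delta> \<subseteq> W"
    "\<forall>s\<in>{a..b}. \<forall>x\<in>cball (z s) \<delta>. \<forall>y\<in>cball (z s) \<delta>.
       norm (X x - X y) \<le> K * norm (x - y)"
    "\<forall>s\<in>{a..b}. norm (X' (z s)) \<le> K"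
    "\<forall>\<epsilon>>0. \<exists>\<rho>>0. \<forall>s\<in>{a..b}. \<forall>x\<in>cball (z s) \<rho>.
       norm (X x - X (z s) - X' (z s) (x - z s)) \<le> \<epsilon> * norm (x - z s)"
proof -
  define C where "C = z ` {a..b}"
  have C: "C \<noteq> {}" "compact C" "C \<subseteq> W"
    using ab z_in z_cont by (auto simp: C_def intro!: compact_continuous_image)
  obtain \<delta> where \<delta>: "\<delta> > 0" "{x. infdist x C \<le> \<delta>} \<subseteq> W"
    using compact_in_open_separated[OF C(1,2) W C(3)] by blast
  define N where "N = {x. infdist x C \<le> \<delta>}"
  have "compact N" unfolding N_def by (rule compact_infdist_le[OF C(1,2) \<delta>(1)])
  have "N \<subseteq> W" using \<delta> by (simp add: N_def)
  have cball_N: "cball (z s) \<delta> \<subseteq> N" if "s \<in> {a..b}" for s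
    using that infdist_le2[of "z s" C _ \<delta>] by (auto simp: N_def C_def dist_commute)
  have cont: "continuous_on N X'" by (rule continuous_on_subset[OF X'_cont \<open>N \<subseteq> W\<close>])
  then have "bounded (X' ` N)"
    using \<open>compact N\<close> by (intro compact_imp_bounded compact_continuous_image)
  then obtain K where K: "K > 0" "\<And>x. x \<in> N \<Longrightarrow> norm (X' x) \<le> K"
    unfolding bounded_pos by auto
  have deriv: "(X has_derivative X' x) (at x within S)" if "x \<in> N" for x S
    using X_deriv \<open>N \<subseteq> W\<close> that by (auto intro: has_derivative_at_withinI)
  show thesis
  proof
    show "\<delta> > 0" "K > 0" by fact+
    show "\<forall>s\<in>{a..b}. cball (z s) \<delta> \<subseteq> W" using cball_N \<open>N \<subseteq> W\<close> by blast
    show "\<forall>s\<in>{a..b}. norm (X' (z s)) \<le> K"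
      using cball_N centre_in_cball[of _ \<delta>] \<delta>(1) by (meson K(2) less_imp_le subsetD)
    have "norm (X x - X y) \<le> K * norm (x - y)"
      if s: "s \<in> {a..b}" and xy: "x \<in> cball (z s) \<delta>" "y \<in> cball (z s) \<delta>" for s x y
      using cball_N[OF s] K(2)
      by (intro differentiable_bound[OF convex_cball _ _ xy, where f' = "\<lambda>x. X' x"])
        (auto intro!: deriv simp: norm_blinfun.rep_eq[symmetric])
    then show "\<forall>s\<in>{a..b}. \<forall>x\<in>cball (z s) \<delta>. \<forall>y\<in>cball (z s) \<delta>.
       norm (X x - X y) \<le> K * norm (x - y)" by blast
    show "\<forall>\<epsilon>>0. \<exists>\<rho>>0. \<forall>s\<in>{a..b}. \<forall>x\<in>cball (z s) \<rho>.
       norm (X x - X (z s) - X' (z s) (x - z s)) \<le> \<epsilon> * norm (x - z s)"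
    proof (intro allI impI)
      fix \<epsilon> :: real assume \<epsilon>: "\<epsilon> > 0"
      obtain d where d: "d > 0"
        "\<And>x x'. x \<in> N \<Longrightarrow> x' \<in> N \<Longrightarrow> dist x' x < d \<Longrightarrow> dist (X' x') (X' x) < \<epsilon>"
        using compact_uniformly_continuous[OF cont \<open>compact N\<close>] \<epsilon>
        unfolding uniformly_continuous_on_def by metis
      define \<rho> where "\<rho> = min \<delta> (d / 2)"
      have \<rho>: "\<rho> > 0" "\<rho> \<le> \<delta>" "\<rho> < d" using \<open>\<delta> > 0\<close> \<open>d > 0\<close> by (auto simp: \<rho>_def)
      have "norm (X x - X (z s) - X' (z s) (x - z s)) \<le> \<epsilon> * norm (x - z s)"
        if s: "s \<in> {a..b}" and x: "x \<in> cball (z s) \<rho>" for s x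
      proof -
        have sub: "cball (z s) \<rho> \<subseteq> N" using cball_N[OF s] \<rho> by auto
        have "norm (X x - X (z s) - X' (z s) (x - z s)) \<le> norm (x - z s) * \<epsilon>"
        proof (rule differentiable_bound_linearization[of "z s" x "cball (z s) \<rho>" X "\<lambda>w. X' w" "z s" \<epsilon>])
          show "z s + t *\<^sub>R (x - z s) \<in> cball (z s) \<rho>" if "t \<in> {0..1}" for t
            using that x mult_mono[of t 1 "norm (x - z s)" \<rho>] \<rho>
            by (auto simp: dist_norm norm_minus_commute)
          show "(X has_derivative X' w) (at w within cball (z s) \<rho>)" if "w \<in> cball (z s) \<rho>" for w
            using deriv sub that by auto
          show "onorm (blinfun_apply (X' w) - blinfun_apply (X' (z s))) \<le> \<epsilon>"
            if w: "w \<in> cball (z s) \<rho>" for w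
          proof -
            have "dist (X' w) (X' (z s)) < \<epsilon>"
              using w sub \<rho> by (intro d(2)) (auto simp: dist_commute)
            then show ?thesis
              by (simp add: dist_norm norm_blinfun.rep_eq minus_blinfun.rep_eq fun_diff_def)
          qed
          show "z s \<in> cball (z s) \<rho>" using \<rho> by simp
        qed
        then show ?thesis by (simp add: mult.commute)
      qed
      with \<rho>(1) show "\<exists>\<rho>>0. \<forall>s\<in>{a..b}. \<forall>x\<in>cball (z s) \<rho>.
         norm (X x - X (z s) - X' (z s) (x - z s)) \<le> \<epsilon> * norm (x - z s)"
        by blast
    qed
  qed
qed

text \<open>Retracting onto the \<open>\<delta>\<close>-tube around \<open>z\<close> makes the field globally Lipschitz; by Gronwall,
  solutions starting close to \<open>z 0\<close> never leave the tube, where the retraction is inactive.\<close>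

lemma nearby_solutions:
  obtains r c where "r > 0" "c > 0"
    "\<And>y. y \<in> ball (z 0) r \<Longrightarrow> \<exists>x. x 0 = y \<and> (\<forall>s\<in>{a..b}.
       (x has_vector_derivative X (x s)) (at s within {a..b}) \<and> x s \<in> W \<and>
       norm (x s - z s) \<le> c * norm (y - z 0))"
proof -
  obtain \<delta> K where \<delta>: "\<delta> > 0" and K: "K > 0"
    and tube_W: "\<forall>s\<in>{a..b}. cball (z s) \<delta> \<subseteq> W"
    and lip: "\<forall>s\<in>{a..b}. \<forall>x\<in>cball (z s) \<delta>. \<forall>y\<in>cball (z s) \<delta>.
       norm (X x - X y) \<le> K * norm (x - y)"
    by (rule tube) (rule that)
  \<comment> \<open>Nearest-point projection onto a ball is nonexpansive, so the retracted field
    keeps the Lipschitz constant \<open>K\<close>.\<close>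
  define proj where "proj = closest_point (cball (0::'a) \<delta>)"
  define ret where "ret s x = z s + proj (x - z s)" for s x
  define F where "F s x = X (ret s x)" for s x
  have proj_in: "norm (proj w) \<le> \<delta>" for w
    using closest_point_in_set[of "cball 0 \<delta>" w] \<delta> by (simp add: proj_def)
  have proj_id: "proj w = w" if "norm w \<le> \<delta>" for w
    using closest_point_self[of w "cball 0 \<delta>"] that by (simp add: proj_def)
  have proj_lip: "dist (proj v) (proj w) \<le> dist v w" for v w
    unfolding proj_def using \<delta> by (intro closest_point_lipschitz) auto
  have proj_cont: "continuous_on S proj" for S
    unfolding proj_def using \<delta> by (intro continuous_on_closest_point) auto
  have ret_tube: "ret s x \<in> cball (z s) \<delta>" for s x using proj_in by (simp add: ret_def dist_norm)
  have ret_id: "ret s x = x" if "norm (x - z s) \<le> \<delta>" for s x using proj_id[OF that] by (simp add: ret_def)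
  have X_cont: "continuous_on W X"
    by (rule has_derivative_continuous_on[OF has_derivative_at_withinI[OF X_deriv]])
  have F_lip: "norm (F s x - F s y) \<le> K * norm (x - y)" if s: "s \<in> {a..b}" for s x y
  proof -
    have "norm (F s x - F s y) \<le> K * norm (ret s x - ret s y)"
      unfolding F_def by (rule lip[rule_format, OF s ret_tube ret_tube])
    also have "\<dots> \<le> K * norm (x - y)"
      using proj_lip[of "x - z s" "y - z s"] K
      by (intro mult_left_mono) (auto simp: ret_def dist_norm)
    finally show ?thesis .
  qed
  have F_cont: "continuous_on {a..b} (\<lambda>s. F s (x s))" if x: "continuous_on {a..b} x" for x
  proof -
    have "continuous_on {a..b} (\<lambda>s. ret s (x s))"
      unfolding ret_def by (intro continuous_intros z_cont continuous_on_compose2[OF proj_cont[of UNIV]] x) auto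
    moreover have "(\<lambda>s. ret s (x s)) ` {a..b} \<subseteq> W"
      by (intro image_subsetI) (rule subsetD[OF bspec[OF tube_W] ret_tube])
    ultimately show ?thesis unfolding F_def by (rule continuous_on_compose2[OF X_cont])
  qed
  \<comment> \<open>The factor in \<open>gronwall\<close> with zero error term; the radius
    \<open>\<delta> / c\<close> below then keeps the solution within distance
    \<open>\<delta>\<close> of \<open>z\<close>.\<close>
  define c where "c = 2 * exp (2 * K * (b - a))"
  have "c > 0" by (simp add: c_def)
  show thesis
  proof
    show "\<delta> / c > 0" "c > 0" using \<delta> \<open>c > 0\<close> by auto
    fix y assume y: "y \<in> ball (z 0) (\<delta> / c)"
    obtain x where "x 0 = y"
      and "\<forall>s\<in>{a..b}. (x has_vector_derivative F s (x s)) (at s within {a..b})"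
      using picard_global[OF ab K F_cont F_lip] by metis
    then have x: "x 0 = y"
      "\<And>s. s \<in> {a..b} \<Longrightarrow> (x has_vector_derivative F s (x s)) (at s within {a..b})"
      by auto
    have near: "norm (x s - z s) \<le> c * norm (y - z 0)" if s: "s \<in> {a..b}" for s
    proof -
      \<comment> \<open>The curve \<open>z\<close> also solves the retracted equation, since it is
        fixed by the retraction; hence the difference obeys a homogeneous Lipschitz bound.\<close>
      have "norm (x s - z s) \<le> 2 * (norm (x 0 - z 0) + 0 * (b - a)) * exp (2 * K * (b - a))"
      proof (rule gronwall[OF ab _ _ K _ s])
        fix t assume t: "t \<in> {a..b}"
        show "((\<lambda>s. x s - z s) has_vector_derivative F t (x t) - F t (z t)) (at t within {a..b})"
          using x(2)[OF t] z_deriv[OF t] \<delta>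
          by (auto intro!: derivative_eq_intros simp: F_def ret_id)
        show "norm (F t (x t) - F t (z t)) \<le> K * norm (x t - z t) + 0" using F_lip[OF t] by simp
      qed simp
      then show ?thesis by (simp add: x(1) c_def mult_ac)
    qed
    have "(x has_vector_derivative X (x s)) (at s within {a..b}) \<and> x s \<in> W"
      if s: "s \<in> {a..b}" for s
    proof -
      have "c * norm (y - z 0) \<le> \<delta>" using y \<open>c > 0\<close> by (simp add: dist_norm norm_minus_commute field_simps)
      then have "norm (x s - z s) \<le> \<delta>" using near[OF s] by linarith
      then have "ret s (x s) = x s" by (rule ret_id)
      then show ?thesis
        using x(2)[OF s] subsetD[OF bspec[OF tube_W s] ret_tube[of s "x s"]] by (simp add: F_def)
    qed
    then show "\<exists>x. x 0 = y \<and> (\<forall>s\<in>{a..b}.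
       (x has_vector_derivative X (x s)) (at s within {a..b}) \<and> x s \<in> W \<and>
       norm (x s - z s) \<le> c * norm (y - z 0))"
      using x(1) near by (intro exI[of _ x]) simp
  qed
qed

text \<open>The competitor may leave every tube around \<open>z\<close>, so the Lipschitz constant
  is taken on the union of the two compact curves, where local Lipschitz continuity of a C^1 field
  becomes global.\<close>

lemma solution_unique:
  assumes x: "x 0 = z 0"
    "\<And>s. s \<in> {a..b} \<Longrightarrow> (x has_vector_derivative X (x s)) (at s within {a..b})"
    "\<And>s. s \<in> {a..b} \<Longrightarrow> x s \<in> W"
    and s: "s \<in> {a..b}"
  shows "x s = z s"
proof -
  let ?C = "x ` {a..b} \<union> z ` {a..b}"
  have "compact ?C"
    using continuous_on_solution[OF x(2)] z_cont
    by (intro compact_Un compact_continuous_image) auto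
  have sub: "?C \<subseteq> W" using x(3) z_in by auto
  have "local_lipschitz UNIV W (\<lambda>_::real. X)"
    using X_deriv W
    by (intro c1_implies_local_lipschitz[where f' = "\<lambda>(t, x). X' x"])
      (auto simp: split_beta intro!: continuous_on_compose2[OF X'_cont] continuous_intros)
  then have "local_lipschitz UNIV ?C (\<lambda>_::real. X)"
    by (rule local_lipschitz_subset) (use sub in auto)
  then obtain K where K: "K-lipschitz_on ?C X"
    using local_lipschitz_compact_implies_lipschitz[of "{0}" ?C "\<lambda>_. X"] \<open>compact ?C\<close>
      local_lipschitz_subset[of UNIV ?C "\<lambda>_::real. X" "{0}" ?C] by (auto simp: continuous_on_sing)
  \<comment> \<open>\<open>K + 1\<close> replaces \<open>K\<close> because \<open>gronwall\<close>
    asks for a positive constant, while a Lipschitz constant may be 0.\<close>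
  have "norm (x s - z s) \<le> 2 * (norm (x 0 - z 0) + 0 * (b - a)) * exp (2 * (K + 1) * (b - a))"
  proof (rule gronwall[OF ab _ _ _ _ s])
    fix t assume t: "t \<in> {a..b}"
    show "((\<lambda>s. x s - z s) has_vector_derivative X (x t) - X (z t)) (at t within {a..b})"
      by (intro derivative_intros x(2)[OF t] z_deriv[OF t])
    have "norm (X (x t) - X (z t)) \<le> K * norm (x t - z t)"
      using lipschitz_onD[OF K, of "x t" "z t"] t by (simp add: dist_norm)
    also have "\<dots> \<le> (K + 1) * norm (x t - z t) + 0" by (simp add: algebra_simps)
    finally show "norm (X (x t) - X (z t)) \<le> (K + 1) * norm (x t - z t) + 0" .
  qed (use lipschitz_on_nonneg[OF K] in auto)
  then show ?thesis by (simp add: x(1))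
qed

text \<open>The linearised equation is globally Lipschitz, so it is solvable for every initial
  vector. Linearity in \<open>v\<close> is uniqueness in disguise: the defect of additivity or
  homogeneity solves the same equation with initial value 0, and Gronwall makes it vanish.\<close>

lemma variational_solution:
  obtains \<eta> where "\<forall>v. \<eta> v 0 = v"
    "\<forall>v. \<forall>s\<in>{a..b}. (\<eta> v has_vector_derivative X' (z s) (\<eta> v s)) (at s within {a..b})"
    "\<forall>s\<in>{a..b}. bounded_linear (\<lambda>v. \<eta> v s)"
proof -
  obtain K where K: "K > 0"
    and X'_bound: "\<forall>s\<in>{a..b}. norm (X' (z s)) \<le> K"
    by (rule tube) (rule that)
  have A_bound: "norm (X' (z s) v) \<le> K * norm v" if "s \<in> {a..b}" for s v
    using norm_blinfun[of "X' (z s)" v] bspec[OF X'_bound that] mult_right_mono[of "norm (X' (z s))" K "norm v"]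
    by simp
  have A_cont: "continuous_on {a..b} (\<lambda>s. X' (z s))"
    using z_in by (intro continuous_on_compose2[OF X'_cont z_cont]) auto
  have "\<exists>\<eta>. \<eta> 0 = v \<and>
      (\<forall>s\<in>{a..b}. (\<eta> has_vector_derivative X' (z s) (\<eta> s)) (at s within {a..b}))" for v
  proof (rule picard_global[OF ab K, of "\<lambda>s. X' (z s)" v])
    show "continuous_on {a..b} (\<lambda>s. X' (z s) (x s))" if "continuous_on {a..b} x" for x
      by (intro continuous_intros A_cont that)
    show "norm (X' (z s) x - X' (z s) y) \<le> K * norm (x - y)" if "s \<in> {a..b}" for s x y
      using A_bound[OF that, of "x - y"] by (simp add: blinfun.diff_right)
  qed (rule exI, rule conjI)
  then obtain \<eta> where \<eta>: "\<And>v. \<eta> v 0 = v"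
    "\<And>v s. s \<in> {a..b} \<Longrightarrow> (\<eta> v has_vector_derivative X' (z s) (\<eta> v s)) (at s within {a..b})"
    by metis
  have zero: "w s = 0" if "w 0 = 0" and s: "s \<in> {a..b}"
    and "\<And>s. s \<in> {a..b} \<Longrightarrow> (w has_vector_derivative X' (z s) (w s)) (at s within {a..b})" for w s
    using gronwall[OF ab that(3) _ K order_refl s] A_bound that(1) by simp
  have "linear (\<lambda>v. \<eta> v s)" if s: "s \<in> {a..b}" for s
  proof
    fix u v :: 'a and k :: real
    have "\<eta> (u + v) s - (\<eta> u s + \<eta> v s) = 0"
      by (rule zero[OF _ s, of "\<lambda>s. \<eta> (u + v) s - (\<eta> u s + \<eta> v s)"])
        (auto intro!: derivative_eq_intros \<eta>(2) simp: \<eta>(1) blinfun.bilinear_simps)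
    then show "\<eta> (u + v) s = \<eta> u s + \<eta> v s" by simp
    have "\<eta> (k *\<^sub>R v) s - k *\<^sub>R \<eta> v s = 0"
      by (rule zero[OF _ s, of "\<lambda>s. \<eta> (k *\<^sub>R v) s - k *\<^sub>R \<eta> v s"])
        (auto intro!: derivative_eq_intros \<eta>(2) simp: \<eta>(1) blinfun.bilinear_simps)
    then show "\<eta> (k *\<^sub>R v) s = k *\<^sub>R \<eta> v s" by simp
  qed
  then show thesis by (intro that[of \<eta>]) (simp_all add: \<eta> linear_conv_bounded_linear)
qed

text \<open>The error \<open>\<phi> y - z - \<eta> (y - z 0)\<close> starts at 0 and solves the
  variational equation up to the Taylor remainder of \<open>X\<close>, which is at most \<epsilon> *
  c times the size of the perturbation; Gronwall passes this smallness on. Solutions are needed only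
  for initial values in \<open>S\<close>, so that \<open>S\<close> can be the bundle.\<close>

lemma flow_has_derivative:
  assumes \<eta>: "\<And>v. \<eta> v 0 = v"
    "\<And>v s. s \<in> {a..b} \<Longrightarrow> (\<eta> v has_vector_derivative X' (z s) (\<eta> v s)) (at s within {a..b})"
    and \<eta>_lin: "\<And>s. s \<in> {a..b} \<Longrightarrow> bounded_linear (\<lambda>v. \<eta> v s)"
    and r: "r > 0" and c: "c > 0"
    and \<phi>: "\<And>y. y \<in> S \<Longrightarrow> y \<in> ball (z 0) r \<Longrightarrow> \<phi> y 0 = y"
      "\<And>y s. y \<in> S \<Longrightarrow> y \<in> ball (z 0) r \<Longrightarrow> s \<in> {a..b} \<Longrightarrow>
        (\<phi> y has_vector_derivative X (\<phi> y s)) (at s within {a..b})"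
      "\<And>y s. y \<in> S \<Longrightarrow> y \<in> ball (z 0) r \<Longrightarrow> s \<in> {a..b} \<Longrightarrow>
        norm (\<phi> y s - z s) \<le> c * norm (y - z 0)"
    and S: "z 0 \<in> S"
    and s: "s \<in> {a..b}"
  shows "((\<lambda>y. \<phi> y s) has_derivative (\<lambda>v. \<eta> v s)) (at (z 0) within S)"
  unfolding has_derivative_within_alt
proof (intro conjI allI impI \<eta>_lin s)
  obtain K where K: "K > 0"
    and X'_bound: "\<forall>s\<in>{a..b}. norm (X' (z s)) \<le> K"
    and lin: "\<forall>\<epsilon>>0. \<exists>\<rho>>0. \<forall>s\<in>{a..b}. \<forall>x\<in>cball (z s) \<rho>.
       norm (X x - X (z s) - X' (z s) (x - z s)) \<le> \<epsilon> * norm (x - z s)"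
    by (rule tube) (rule that)
  fix e :: real assume "e > 0"
  \<comment> \<open>All constants of the Gronwall bound; the summand 1 keeps \<open>E\<close>
    positive when a = b.\<close>
  define E where "E = 2 * exp (2 * K * (b - a)) * c * (b - a + 1)"
  have "E > 0" using c ab by (simp add: E_def)
  define \<epsilon> where "\<epsilon> = e / E"
  have "\<epsilon> > 0" using \<open>e > 0\<close> \<open>E > 0\<close> by (simp add: \<epsilon>_def)
  then obtain \<rho> where "\<rho> > 0" and \<rho>: "\<And>s x. s \<in> {a..b} \<Longrightarrow> x \<in> cball (z s) \<rho> \<Longrightarrow>
       norm (X x - X (z s) - X' (z s) (x - z s)) \<le> \<epsilon> * norm (x - z s)"
    using lin by blast
  \<comment> \<open>The second entry keeps \<open>\<phi> y t\<close> within \<open>\<rho>\<close> of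
    \<open>z t\<close> at all times, where the linearisation bound applies.\<close>
  define d where "d = min r (\<rho> / c)"
  have "norm (\<phi> y s - \<phi> (z 0) s - \<eta> (y - z 0) s) \<le> e * norm (y - z 0)"
    if y: "y \<in> S" "norm (y - z 0) < d" for y
  proof -
    have y_ball: "y \<in> ball (z 0) r" using y(2) by (simp add: d_def dist_norm norm_minus_commute)
    have z0: "\<phi> (z 0) s = z s" using \<phi>(3)[OF S _ s] r by simp
    let ?h = "y - z 0"
    let ?rem = "\<lambda>t. X (\<phi> y t) - X (z t) - X' (z t) (\<phi> y t - z t)"
    let ?R = "\<lambda>t. \<phi> y t - z t - \<eta> ?h t"
    have "norm (?R s) \<le> 2 * (norm (?R 0) + \<epsilon> * c * norm ?h * (b - a)) * exp (2 * K * (b - a))"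
    proof (rule gronwall[OF ab _ _ K _ s])
      fix t assume t: "t \<in> {a..b}"
      show "(?R has_vector_derivative X' (z t) (?R t) + ?rem t) (at t within {a..b})"
        using \<phi>(2)[OF y(1) y_ball t] z_deriv[OF t] \<eta>(2)[OF t, of ?h]
        by (auto intro!: derivative_eq_intros simp: blinfun.bilinear_simps)
      have n: "norm (\<phi> y t - z t) \<le> c * norm ?h" by (rule \<phi>(3)[OF y(1) y_ball t])
      also have "c * norm ?h \<le> \<rho>" using y(2) c by (simp add: d_def field_simps)
      finally have "norm (?rem t) \<le> \<epsilon> * norm (\<phi> y t - z t)"
        by (intro \<rho>[OF t]) (simp add: dist_norm norm_minus_commute)
      also have "\<dots> \<le> \<epsilon> * (c * norm ?h)" using n \<open>\<epsilon> > 0\<close> by (intro mult_left_mono) auto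
      finally have "norm (?rem t) \<le> \<epsilon> * c * norm ?h" by simp
      moreover have "norm (X' (z t) (?R t)) \<le> K * norm (?R t)"
        using norm_blinfun[of "X' (z t)" "?R t"] bspec[OF X'_bound t]
          mult_right_mono[of "norm (X' (z t))" K "norm (?R t)"] by simp
      ultimately show "norm (X' (z t) (?R t) + ?rem t) \<le> K * norm (?R t) + \<epsilon> * c * norm ?h"
        by (intro norm_triangle_le) linarith
    qed (use c \<open>\<epsilon> > 0\<close> in auto)
    also have "?R 0 = 0" using \<phi>(1)[OF y(1) y_ball] \<eta>(1) by simp
    also have "2 * (norm (0::'a) + \<epsilon> * c * norm ?h * (b - a)) * exp (2 * K * (b - a))
        = 2 * exp (2 * K * (b - a)) * c * (b - a) * (\<epsilon> * norm ?h)"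
      by (simp add: mult_ac)
    also have "\<dots> \<le> E * (\<epsilon> * norm ?h)"
      unfolding E_def using c \<open>\<epsilon> > 0\<close> by (intro mult_right_mono mult_left_mono) auto
    also have "\<dots> = e * norm ?h" using \<open>E > 0\<close> by (simp add: \<epsilon>_def)
    finally show ?thesis by (simp add: z0)
  qed
  moreover have "d > 0" using r \<open>\<rho> > 0\<close> c by (simp add: d_def)
  ultimately show "\<exists>d>0. \<forall>y\<in>S. norm (y - z 0) < d \<longrightarrow>
      norm (\<phi> y s - \<phi> (z 0) s - \<eta> (y - z 0) s) \<le> e * norm (y - z 0)" by blast
qed

end

subsection \<open>Symmetry of second derivatives\<close>

lemma line_has_real_derivative:
  fixes f :: "'a::real_normed_vector \<Rightarrow> real"
  assumes "(f has_derivative f') (at (c + s *\<^sub>R u))"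
  shows "((\<lambda>s. f (c + s *\<^sub>R u)) has_real_derivative f' u) (at s)"
proof -
  have "((\<lambda>s. c + s *\<^sub>R u) has_vector_derivative u) (at s)"
    by (auto intro!: derivative_eq_intros)
  from vector_derivative_diff_chain_within[OF this has_derivative_at_withinI[OF assms]]
  have "(f \<circ> (\<lambda>s. c + s *\<^sub>R u) has_vector_derivative f' u) (at s)" .
  then show ?thesis by (simp add: has_real_derivative_iff_has_vector_derivative o_def)
qed

text \<open>The second difference is the increment in direction \<open>u\<close> of the difference
  of \<open>f\<close> in direction \<open>v\<close>. The mean value theorem is applied in
  \<open>u\<close> and then, to the resulting first derivative, in \<open>v\<close>.\<close>

lemma second_difference_mvt:
  fixes f :: "'a::real_normed_vector \<Rightarrow> real"
  assumes f': "\<And>x. (f has_derivative f' x) (at x)"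
    and fu: "\<And>x. ((\<lambda>x. f' x u) has_derivative fu x) (at x)"
    and t: "t > 0"
  shows "\<exists>p. norm (p - x) \<le> t * (norm u + norm v) \<and>
     f (x + t *\<^sub>R u + t *\<^sub>R v) - f (x + t *\<^sub>R u) - f (x + t *\<^sub>R v) + f x = t * (t * fu p v)"
proof -
  let ?\<phi> = "\<lambda>s. f (x + t *\<^sub>R v + s *\<^sub>R u) - f (x + s *\<^sub>R u)"
  have "\<exists>\<sigma>>0. \<sigma> < t \<and> ?\<phi> t - ?\<phi> 0
      = (t - 0) * (f' (x + t *\<^sub>R v + \<sigma> *\<^sub>R u) u - f' (x + \<sigma> *\<^sub>R u) u)"
    by (intro MVT2 t allI impI DERIV_diff line_has_real_derivative f')
  then obtain \<sigma> where \<sigma>: "0 < \<sigma>" "\<sigma> < t"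
    "?\<phi> t - ?\<phi> 0 = t * (f' (x + t *\<^sub>R v + \<sigma> *\<^sub>R u) u - f' (x + \<sigma> *\<^sub>R u) u)" by auto
  let ?\<psi> = "\<lambda>s. f' (x + \<sigma> *\<^sub>R u + s *\<^sub>R v) u"
  have "\<exists>\<tau>>0. \<tau> < t \<and> ?\<psi> t - ?\<psi> 0 = (t - 0) * fu (x + \<sigma> *\<^sub>R u + \<tau> *\<^sub>R v) v"
    by (intro MVT2 t allI impI line_has_real_derivative fu)
  then obtain \<tau> where \<tau>: "0 < \<tau>" "\<tau> < t"
    "?\<psi> t - ?\<psi> 0 = t * fu (x + \<sigma> *\<^sub>R u + \<tau> *\<^sub>R v) v" by auto
  have "norm (x + \<sigma> *\<^sub>R u + \<tau> *\<^sub>R v - x) \<le> \<sigma> * norm u + \<tau> * norm v"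
    using \<sigma> \<tau> norm_triangle_ineq[of "\<sigma> *\<^sub>R u" "\<tau> *\<^sub>R v"] by simp
  also have "\<dots> \<le> t * norm u + t * norm v"
    using \<sigma> \<tau> by (intro add_mono mult_right_mono) auto
  finally have "norm (x + \<sigma> *\<^sub>R u + \<tau> *\<^sub>R v - x) \<le> t * (norm u + norm v)"
    by (simp add: distrib_left)
  moreover have "f (x + t *\<^sub>R u + t *\<^sub>R v) - f (x + t *\<^sub>R u) - f (x + t *\<^sub>R v) + f x
      = ?\<phi> t - ?\<phi> 0" by (simp add: add_ac)
  moreover have "\<dots> = t * (?\<psi> t - ?\<psi> 0)" using \<sigma>(3) by (simp add: add_ac)
  ultimately show ?thesis using \<tau>(3) by metis
qed

text \<open>The second difference does not change when \<open>u\<close> and \<open>v\<close> are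
  exchanged, so it equals t^2 times either mixed derivative, each at some point close to
  \<open>x\<close>. For small t continuity contradicts a positive gap at \<open>x\<close>.\<close>

lemma mixed_derivatives_symmetric:
  fixes f :: "'a::real_normed_vector \<Rightarrow> real"
  assumes f': "\<And>x. (f has_derivative f' x) (at x)"
    and fu: "\<And>x. ((\<lambda>x. f' x u) has_derivative fu x) (at x)"
    and fv: "\<And>x. ((\<lambda>x. f' x v) has_derivative fv x) (at x)"
    and cont: "isCont (\<lambda>x. fu x v) x" "isCont (\<lambda>x. fv x u) x"
  shows "fu x v = fv x u"
proof (rule ccontr)
  assume "fu x v \<noteq> fv x u"
  define e where "e = \<bar>fu x v - fv x u\<bar> / 2"
  have "e > 0" using \<open>fu x v \<noteq> fv x u\<close> by (simp add: e_def)
  obtain d1 where d1: "d1 > 0" "\<And>p. norm (p - x) < d1 \<Longrightarrow> \<bar>fu p v - fu x v\<bar> < e"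
    using cont(1) \<open>e > 0\<close> unfolding continuous_at_eps_delta dist_norm by (metis real_norm_def)
  obtain d2 where d2: "d2 > 0" "\<And>p. norm (p - x) < d2 \<Longrightarrow> \<bar>fv p u - fv x u\<bar> < e"
    using cont(2) \<open>e > 0\<close> unfolding continuous_at_eps_delta dist_norm by (metis real_norm_def)
  define n where "n = norm u + norm v"
  have "n \<ge> 0" by (simp add: n_def)
  \<comment> \<open>Chosen so that both intermediate points, at distance at most
    \<open>t * n\<close>, lie within both continuity radii; the summand 1 covers u = v = 0.\<close>
  define t where "t = min d1 d2 / (n + 1)"
  have t: "t > 0" using d1 d2 \<open>n \<ge> 0\<close> by (simp add: t_def)
  have "t * n < t * (n + 1)" using t by simp
  also have "\<dots> = min d1 d2" using \<open>n \<ge> 0\<close> by (simp add: t_def)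
  finally have small: "t * n < d1" "t * n < d2" by auto
  obtain p where p: "norm (p - x) \<le> t * n"
    "f (x + t *\<^sub>R u + t *\<^sub>R v) - f (x + t *\<^sub>R u) - f (x + t *\<^sub>R v) + f x = t * (t * fu p v)"
    using second_difference_mvt[OF f' fu t, of x v] by (auto simp: n_def)
  obtain q where q: "norm (q - x) \<le> t * n"
    "f (x + t *\<^sub>R v + t *\<^sub>R u) - f (x + t *\<^sub>R v) - f (x + t *\<^sub>R u) + f x = t * (t * fv q u)"
    using second_difference_mvt[OF f' fv t, of x u] by (auto simp: n_def add.commute)
  have eq: "x + t *\<^sub>R v + t *\<^sub>R u = x + t *\<^sub>R u + t *\<^sub>R v" by simp
  have "t * (t * fu p v) = t * (t * fv q u)"
    using p(2) q(2)[unfolded eq] by linarith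
  then have "fu p v = fv q u" using t by simp
  moreover have "\<bar>fu p v - fu x v\<bar> < e" using p(1) small by (intro d1) auto
  moreover have "\<bar>fv q u - fv x u\<bar> < e" using q(1) small by (intro d2) auto
  ultimately show False unfolding e_def by (simp add: abs_if field_simps split: if_splits)
qed

subsection \<open>Continuously differentiable maps on a set\<close>

text \<open>The derivative is asked to be continuous in each direction separately. This is what
  iterated directional derivatives provide and what sum and product rules preserve directly; in
  finite dimension it is equivalent to continuity in operator norm.\<close>

definition C1_on :: "'a::euclidean_space set \<Rightarrow> ('a \<Rightarrow> 'b::real_normed_vector) \<Rightarrow> bool" where
  "C1_on W f \<longleftrightarrow> (\<exists>f'. (\<forall>x\<in>W. (f has_derivative f' x) (at x)) \<and>
     (\<forall>v. continuous_on W (\<lambda>x. f' x v)))"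

lemma C1_onI:
  assumes "\<And>x. x \<in> W \<Longrightarrow> (f has_derivative f' x) (at x)"
    and "\<And>v. continuous_on W (\<lambda>x. f' x v)"
  shows "C1_on W f"
  using assms unfolding C1_on_def by (intro exI[of _ f']) simp

lemma C1_onE:
  assumes "C1_on W f"
  obtains f' where "\<And>x. x \<in> W \<Longrightarrow> (f has_derivative f' x) (at x)"
    and "\<And>v. continuous_on W (\<lambda>x. f' x v)"
  using assms unfolding C1_on_def by auto

text \<open>Passes from continuity in each direction to the operator norm, the form that
  \<open>reference_solution\<close> uses for boundedness and uniform continuity on compact
  sets.\<close>

lemma C1_on_blinfunE:
  fixes f :: "'a::euclidean_space \<Rightarrow> 'b::real_normed_vector"
  assumes "C1_on W f"
  obtains f' :: "'a \<Rightarrow> 'a \<Rightarrow>\<^sub>L 'b"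
    where "\<And>x. x \<in> W \<Longrightarrow> (f has_derivative f' x) (at x)" and "continuous_on W f'"
proof -
  obtain f' where f': "\<And>x. x \<in> W \<Longrightarrow> (f has_derivative f' x) (at x)"
    "\<And>v. continuous_on W (\<lambda>x. f' x v)" using C1_onE[OF assms] by metis
  have B: "blinfun_apply (Blinfun (f' x)) = f' x" if "x \<in> W" for x
    using f'(1)[OF that] by (intro bounded_linear_Blinfun_apply has_derivative_bounded_linear)
  show thesis
  proof
    show "(f has_derivative Blinfun (f' x)) (at x)" if "x \<in> W" for x
      using f'(1)[OF that] B[OF that] by simp
    show "continuous_on W (\<lambda>x. Blinfun (f' x))"
      using f'(2) B by (intro continuous_on_blinfun_componentwise) (simp cong: continuous_on_cong)
  qed
qed

lemma C1_on_imp_continuous_on: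
  assumes "C1_on W f"
  shows "continuous_on W f"
proof -
  obtain f' where "\<And>x. x \<in> W \<Longrightarrow> (f has_derivative f' x) (at x)" using C1_onE[OF assms] by metis
  then show ?thesis by (rule has_derivative_continuous_on[OF has_derivative_at_withinI])
qed

lemma C1_on_const: "C1_on W (\<lambda>x. c)"
  by (rule C1_onI[of _ _ "\<lambda>_ _. 0"]) auto

lemma C1_on_linear_compose:
  assumes "C1_on W f" "bounded_linear l"
  shows "C1_on W (\<lambda>x. l (f x))"
proof -
  obtain f' where f': "\<And>x. x \<in> W \<Longrightarrow> (f has_derivative f' x) (at x)"
    "\<And>v. continuous_on W (\<lambda>x. f' x v)" using C1_onE[OF assms(1)] by metis
  show ?thesis
    by (rule C1_onI[of _ _ "\<lambda>x h. l (f' x h)"])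
      (auto intro!: f' bounded_linear.has_derivative[OF assms(2)] bounded_linear.continuous_on[OF assms(2)])
qed

lemma C1_on_compose_linear:
  assumes "C1_on V f" "bounded_linear l" "\<And>x. x \<in> W \<Longrightarrow> l x \<in> V"
  shows "C1_on W (\<lambda>x. f (l x))"
proof -
  obtain f' where f': "\<And>x. x \<in> V \<Longrightarrow> (f has_derivative f' x) (at x)"
    "\<And>v. continuous_on V (\<lambda>x. f' x v)" using C1_onE[OF assms(1)] by metis
  show ?thesis
  proof (rule C1_onI[of _ _ "\<lambda>x h. f' (l x) (l h)"])
    show "((\<lambda>x. f (l x)) has_derivative (\<lambda>h. f' (l x) (l h))) (at x)" if "x \<in> W" for x
      by (rule has_derivative_compose[OF bounded_linear_imp_has_derivative[OF assms(2)] f'(1)])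
        (rule assms(3)[OF that])
    show "continuous_on W (\<lambda>x. f' (l x) (l v))" for v
      using assms(3)
      by (intro continuous_on_compose2[OF f'(2)] linear_continuous_on assms(2)) auto
  qed
qed

lemma C1_on_bounded_linear: "bounded_linear l \<Longrightarrow> C1_on W l"
  by (rule C1_onI[of _ _ "\<lambda>_. l"]) (auto intro: bounded_linear_imp_has_derivative)

lemma C1_on_add:
  assumes "C1_on W f" "C1_on W g"
  shows "C1_on W (\<lambda>x. f x + g x)"
proof -
  obtain f' where f': "\<And>x. x \<in> W \<Longrightarrow> (f has_derivative f' x) (at x)"
    "\<And>v. continuous_on W (\<lambda>x. f' x v)" using C1_onE[OF assms(1)] by metis
  obtain g' where g': "\<And>x. x \<in> W \<Longrightarrow> (g has_derivative g' x) (at x)"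
    "\<And>v. continuous_on W (\<lambda>x. g' x v)" using C1_onE[OF assms(2)] by metis
  show ?thesis
    by (rule C1_onI[of _ _ "\<lambda>x h. f' x h + g' x h"]) (auto intro!: has_derivative_add continuous_on_add f' g')
qed

lemma C1_on_minus: "C1_on W f \<Longrightarrow> C1_on W (\<lambda>x. - f x)"
  by (rule C1_on_linear_compose) (auto intro: bounded_linear_minus bounded_linear_ident)

lemma C1_on_diff: "C1_on W f \<Longrightarrow> C1_on W g \<Longrightarrow> C1_on W (\<lambda>x. f x - g x)"
  using C1_on_add[of W f "\<lambda>x. - g x"] C1_on_minus[of W g] by simp

lemma C1_on_sum: "(\<And>i. i \<in> I \<Longrightarrow> C1_on W (f i)) \<Longrightarrow> C1_on W (\<lambda>x. \<Sum>i\<in>I. f i x)"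
  by (induction I rule: infinite_finite_induct) (auto intro: C1_on_const C1_on_add)

lemma C1_on_bilinear:
  assumes "bounded_bilinear B" "C1_on W f" "C1_on W g"
  shows "C1_on W (\<lambda>x. B (f x) (g x))"
proof -
  obtain f' where f': "\<And>x. x \<in> W \<Longrightarrow> (f has_derivative f' x) (at x)"
    "\<And>v. continuous_on W (\<lambda>x. f' x v)" using C1_onE[OF assms(2)] by metis
  obtain g' where g': "\<And>x. x \<in> W \<Longrightarrow> (g has_derivative g' x) (at x)"
    "\<And>v. continuous_on W (\<lambda>x. g' x v)" using C1_onE[OF assms(3)] by metis
  show ?thesis
    by (rule C1_onI[of _ _ "\<lambda>x h. B (f x) (g' x h) + B (f' x h) (g x)"])
      (intro bounded_bilinear.FDERIV[OF assms(1)] bounded_bilinear.continuous_on[OF assms(1)]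
        continuous_intros C1_on_imp_continuous_on assms(2,3) f' g'; assumption)+
qed

lemmas C1_on_scaleR = C1_on_bilinear[OF bounded_bilinear_scaleR]
lemmas C1_on_mult = C1_on_bilinear[OF bounded_bilinear_mult]

lemma C1_on_prod:
  fixes f :: "'i \<Rightarrow> 'a::euclidean_space \<Rightarrow> 'b::real_normed_field"
  shows "(\<And>i. i \<in> I \<Longrightarrow> C1_on W (f i)) \<Longrightarrow> C1_on W (\<lambda>x. \<Prod>i\<in>I. f i x)"
  by (induction I rule: infinite_finite_induct) (auto intro: C1_on_const C1_on_mult)

lemma C1_on_divide:
  fixes f g :: "'a::euclidean_space \<Rightarrow> real"
  assumes "C1_on W f" "C1_on W g" "\<And>x. x \<in> W \<Longrightarrow> g x \<noteq> 0"
  shows "C1_on W (\<lambda>x. f x / g x)"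
proof -
  obtain g' where g': "\<And>x. x \<in> W \<Longrightarrow> (g has_derivative g' x) (at x)"
    "\<And>v. continuous_on W (\<lambda>x. g' x v)" using C1_onE[OF assms(2)] by metis
  have "C1_on W (\<lambda>x. inverse (g x))"
  proof (rule C1_onI[of _ _ "\<lambda>x h. - (inverse (g x) * g' x h * inverse (g x))"])
    show "((\<lambda>x. inverse (g x)) has_derivative (\<lambda>h. - (inverse (g x) * g' x h * inverse (g x)))) (at x)"
      if "x \<in> W" for x
      using that by (intro Deriv.has_derivative_inverse g' assms(3))
    show "continuous_on W (\<lambda>x. - (inverse (g x) * g' x v * inverse (g x)))" for v
      using assms(3) by (intro continuous_intros C1_on_imp_continuous_on assms(2) g') auto
  qed
  then show ?thesis using C1_on_mult[OF assms(1)] by (simp add: divide_inverse)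
qed

lemma C1_on_Pair:
  assumes "C1_on W f" "C1_on W g"
  shows "C1_on W (\<lambda>x. (f x, g x))"
proof -
  have "C1_on W (\<lambda>x. (f x, 0) + (0, g x))"
    by (intro C1_on_add C1_on_linear_compose[OF assms(1)] C1_on_linear_compose[OF assms(2)]
      bounded_linear_Pair bounded_linear_ident bounded_linear_zero)
  then show ?thesis by simp
qed

lemma C1_on_component: "C1_on W f \<Longrightarrow> C1_on W (\<lambda>x. f x $ i)"
  by (rule C1_on_linear_compose) (auto intro: bounded_linear_vec_nth)

lemma C1_on_vec:
  fixes f :: "'a::euclidean_space \<Rightarrow> real ^ 'n"
  assumes "\<And>i. C1_on W (\<lambda>x. f x $ i)"
  shows "C1_on W f"
proof -
  have "C1_on W (\<lambda>x. \<Sum>i\<in>UNIV. f x $ i *\<^sub>R axis i (1::real))"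
    by (intro C1_on_sum C1_on_scaleR C1_on_const assms)
  also have "(\<lambda>x. \<Sum>i\<in>UNIV. f x $ i *\<^sub>R axis i (1::real)) = f"
    using basis_expansion[of "f _"] by (simp add: scalar_mult_eq_scaleR)
  finally show ?thesis .
qed

lemma C1_on_det:
  fixes A :: "'a::euclidean_space \<Rightarrow> real ^ 'n ^ 'n"
  assumes "\<And>i j. C1_on W (\<lambda>x. A x $ i $ j)"
  shows "C1_on W (\<lambda>x. det (A x))"
  unfolding det_def by (intro C1_on_sum C1_on_mult C1_on_prod C1_on_const assms)

lemma smooth_frechet_derivative:
  assumes "smooth f"
  shows "smooth (\<lambda>x. frechet_derivative f (at x) v)"
  using assms unfolding smooth_def by (metis times_cont_diff.simps(2))

lemma smooth_has_derivative:
  assumes "smooth f"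
  shows "(f has_derivative frechet_derivative f (at x)) (at x)"
  using assms frechet_derivative_works unfolding smooth_def by (metis times_cont_diff.simps(2))

lemma smooth_continuous: "smooth f \<Longrightarrow> continuous_on UNIV f"
  unfolding smooth_def by (metis times_cont_diff.simps(1))

lemma smooth_C1_on:
  assumes "smooth f"
  shows "C1_on UNIV f"
  by (rule C1_onI[OF smooth_has_derivative[OF assms]])
    (rule smooth_continuous[OF smooth_frechet_derivative[OF assms]])

lemma smooth_second_derivative_symmetric:
  fixes f :: "'a::euclidean_space \<Rightarrow> 'b::euclidean_space"
  assumes "smooth f"
  shows "frechet_derivative (\<lambda>y. frechet_derivative f (at y) u) (at x) v
    = frechet_derivative (\<lambda>y. frechet_derivative f (at y) v) (at x) u"
proof (rule euclidean_eqI)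
  fix b :: 'b
  let ?D = "\<lambda>x. frechet_derivative f (at x)"
  let ?D2 = "\<lambda>u x. frechet_derivative (\<lambda>y. ?D y u) (at x)"
  have D2: "((\<lambda>x. ?D x u) has_derivative ?D2 u x) (at x)" for u x
    by (rule smooth_has_derivative[OF smooth_frechet_derivative[OF assms]])
  have "isCont (\<lambda>x. ?D2 u x v \<bullet> b) x" for u v x
    using smooth_continuous[OF smooth_frechet_derivative[OF smooth_frechet_derivative[OF assms]]]
    by (intro continuous_intros) (simp add: continuous_on_eq_continuous_at)
  then show "?D2 u x v \<bullet> b = ?D2 v x u \<bullet> b"
    by (intro mixed_derivatives_symmetric[where f = "\<lambda>x. f x \<bullet> b" and f' = "\<lambda>x h. ?D x h \<bullet> b"
        and fu = "\<lambda>x h. ?D2 u x h \<bullet> b" and fv = "\<lambda>x h. ?D2 v x h \<bullet> b"]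
      has_derivative_inner_left smooth_has_derivative[OF assms] D2)
qed

subsection \<open>The constrained magnetic system\<close>

lemma grad_eqI:
  fixes f :: "'a::euclidean_space \<Rightarrow> real"
  assumes "GDERIV f x :> D"
  shows "grad f x = D"
  unfolding grad_def
proof (rule the_equality)
  show "GDERIV f x :> D" by fact
  fix D' assume "GDERIV f x :> D'"
  then have "(\<lambda>h. h \<bullet> D') = (\<lambda>h. h \<bullet> D)"
    using assms unfolding gderiv_def by (rule has_derivative_unique)
  then have "\<forall>h. h \<bullet> D' = h \<bullet> D" by (simp add: fun_eq_iff)
  then show "D' = D" by (simp only: vector_eq_ldot)
qed

lemma grad_hamiltonian:
  assumes "(U has_derivative (\<lambda>h. h \<bullet> D)) (at q)"
  shows "grad_q (hamiltonian U) (q, p) = D" and "grad_p (hamiltonian U) (q, p) = p"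
proof -
  have "((\<lambda>q. U q + 1 / 2 * (p \<bullet> p)) has_derivative (\<lambda>h. h \<bullet> D + 0)) (at q)"
    by (intro has_derivative_add assms has_derivative_const)
  then show "grad_q (hamiltonian U) (q, p) = D"
    by (simp add: grad_q_def hamiltonian_def grad_eqI gderiv_def)
  have "((\<lambda>p. U q + 1 / 2 * (p \<bullet> p)) has_derivative
      (\<lambda>h. 0 + 1 / 2 * (p \<bullet> h + h \<bullet> p))) (at p)"
    by (intro has_derivative_add has_derivative_mult_right has_derivative_inner
      has_derivative_const has_derivative_ident)
  also have "(\<lambda>h. 0 + 1 / 2 * (p \<bullet> h + h \<bullet> p)) = (\<lambda>h. h \<bullet> p)"
    by (simp add: inner_commute[of p])
  finally show "grad_p (hamiltonian U) (q, p) = p"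
    by (simp add: grad_p_def hamiltonian_def grad_eqI gderiv_def)
qed

lemma Omega_mag_alt:
  "Omega_mag L u v = fst u \<bullet> (L *v fst v + snd v) - snd u \<bullet> fst v"
  by (cases u; cases v) (simp add: Omega_mag_def J_mag_def)

lemma bounded_bilinear_Omega_mag: "bounded_bilinear (Omega_mag L)"
proof -
  have "bounded_linear (J_mag L)"
    unfolding J_mag_def split_beta
    by (intro bounded_linear_Pair bounded_linear_add bounded_linear_minus bounded_linear_fst
      bounded_linear_snd bounded_linear_compose[OF matrix_vector_mul_bounded_linear])
  from bounded_bilinear.comp[OF bounded_bilinear_inner bounded_linear_ident this] show ?thesis
    unfolding Omega_mag_def[abs_def] .
qed

text \<open>A derivative within \<open>S\<close> may be ambiguous in normal directions. Composing
  with a curve in \<open>S\<close> of velocity \<open>u\<close> removes the ambiguity: both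
  \<open>D u\<close> and \<open>D' u\<close> are the velocity of the image curve.\<close>

lemma has_derivative_tangent_unique:
  assumes F: "(F has_derivative D) (at z within S)" "(F has_derivative D') (at z within S)"
    and u: "u \<in> tangent_space S z"
  shows "D u = D' u"
proof -
  obtain c e where c: "e > 0" "\<And>s. s \<in> {-e<..<e} \<Longrightarrow> c s \<in> S" "c 0 = z"
    "(c has_vector_derivative u) (at 0)"
    using u unfolding tangent_space_def by blast
  have at: "at 0 within {-e<..<e} = at (0::real)" using c(1) by (intro at_within_open) auto
  have c': "(c has_vector_derivative u) (at 0 within {-e<..<e})" using c(4) at by simp
  have Fc: "(F \<circ> c has_vector_derivative E u) (at 0)" if "(F has_derivative E) (at z within S)" for E
  proof -
    have "(F has_derivative E) (at (c 0) within c ` {-e<..<e})"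
      unfolding c(3) by (rule has_derivative_subset[OF that]) (use c(2) in auto)
    from vector_derivative_diff_chain_within[OF c' this] show ?thesis by (simp add: at)
  qed
  show ?thesis by (rule vector_derivative_unique_at[OF Fc[OF F(1)] Fc[OF F(2)]])
qed

text \<open>Smoothness gives regularity of a derivative in a fixed direction. The expansion handles
  directions that vary with the point, as in \<open>Dg (fst z) (snd z)\<close>, by reducing them to
  coefficients times derivatives along the axes.\<close>

lemma linear_axis_expansion:
  fixes f :: "real^'m \<Rightarrow> 'b::real_normed_vector"
  assumes "bounded_linear f"
  shows "f v = (\<Sum>i\<in>UNIV. v $ i *\<^sub>R f (axis i 1))"
proof -
  have "f (\<Sum>i\<in>UNIV. v $ i *\<^sub>R axis i 1) = (\<Sum>i\<in>UNIV. v $ i *\<^sub>R f (axis i 1))"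
    using assms by (simp add: bounded_linear.linear linear_sum linear_scale)
  then show ?thesis using basis_expansion[of v] by (simp add: scalar_mult_eq_scaleR)
qed

section \<open>Derivatives of the constraint and the Lagrange multiplier\<close>

locale constrained_magnetic =
  fixes g :: "real^'m \<Rightarrow> real^'k" and U :: "real^'m \<Rightarrow> real" and L :: "real^'m^'m"
  assumes g_smooth: "smooth g" and U_smooth: "smooth U"
    and full_rank: "\<And>q. g q = 0 \<Longrightarrow> rank (Jac g q) = CARD('k)"
    and L_skew: "transpose L = - L"
begin

definition Dg :: "real^'m \<Rightarrow> real^'m \<Rightarrow> real^'k" where
  "Dg q = frechet_derivative g (at q)"

definition D2g :: "real^'m \<Rightarrow> real^'m \<Rightarrow> real^'m \<Rightarrow> real^'k" where
  "D2g q u = frechet_derivative (\<lambda>x. Dg x u) (at q)"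

definition gradU :: "real^'m \<Rightarrow> real^'m" where
  "gradU q = (\<chi> i. frechet_derivative U (at q) (axis i 1))"

definition hessU :: "real^'m \<Rightarrow> real^'m \<Rightarrow> real^'m" where
  "hessU q v = (\<chi> i. frechet_derivative (\<lambda>x. frechet_derivative U (at x) (axis i 1)) (at q) v)"

definition Gram :: "real^'m \<Rightarrow> real^'k^'k" where
  "Gram q = Jac g q ** transpose (Jac g q)"

text \<open>Neither constraint of the bundle is imposed and p is unrestricted, so that this can be a
  full neighbourhood of the bundle in phase space, on which \<open>X\<close> is linearised in all
  directions.\<close>

definition regular :: "((real^'m) \<times> (real^'m)) set" where
  "regular = {z. det (Gram (fst z)) \<noteq> 0}"

text \<open>Differentiating \<open>g (q t) = 0\<close> twice gives the linear system \<open>Gram q *v \<lambda> = rhs (q, p)\<close> for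
  the multiplier; Cramer's rule makes its solution an explicit rational expression,
  defined and continuously differentiable also off the constraint manifold.\<close>

definition rhs :: "(real^'m) \<times> (real^'m) \<Rightarrow> real^'k" where
  "rhs z = D2g (fst z) (snd z) (snd z) - Dg (fst z) (gradU (fst z) + L *v snd z)"

definition multiplier :: "(real^'m) \<times> (real^'m) \<Rightarrow> real^'k" where
  "multiplier z = (\<chi> k. det (\<chi> i j. if j = k then rhs z $ i else Gram (fst z) $ i $ j)
     / det (Gram (fst z)))"

definition X :: "(real^'m) \<times> (real^'m) \<Rightarrow> (real^'m) \<times> (real^'m)" where
  "X z = (snd z, - gradU (fst z) - L *v snd z - transpose (Jac g (fst z)) *v multiplier z)"

lemma Dg_has_derivative: "(g has_derivative Dg q) (at q)"
  unfolding Dg_def by (rule smooth_has_derivative[OF g_smooth])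

lemma bounded_linear_Dg: "bounded_linear (Dg q)"
  by (rule has_derivative_bounded_linear[OF Dg_has_derivative])

lemma smooth_Dg: "smooth (\<lambda>q. Dg q u)"
  unfolding Dg_def by (rule smooth_frechet_derivative[OF g_smooth])

lemma smooth_D2g: "smooth (\<lambda>q. D2g q u v)"
  unfolding D2g_def by (rule smooth_frechet_derivative[OF smooth_Dg])

lemma D2g_has_derivative: "((\<lambda>x. Dg x u) has_derivative D2g q u) (at q)"
  unfolding D2g_def by (rule smooth_has_derivative[OF smooth_Dg])

lemma bounded_linear_D2g: "bounded_linear (D2g q u)"
  by (rule has_derivative_bounded_linear[OF D2g_has_derivative])

lemma D2g_sym: "D2g q u v = D2g q v u"
  unfolding D2g_def Dg_def by (rule smooth_second_derivative_symmetric[OF g_smooth])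

lemma Dg_expansion: "Dg q v = (\<Sum>i\<in>UNIV. v $ i *\<^sub>R Dg q (axis i 1))"
  by (rule linear_axis_expansion[OF bounded_linear_Dg])

text \<open>As a derivative, \<open>D2g\<close> is linear in its last argument; linearity in the
  middle one is borrowed from there through symmetry.\<close>

lemma D2g_expansion: "D2g q v w = (\<Sum>i\<in>UNIV. v $ i *\<^sub>R D2g q (axis i 1) w)"
  using linear_axis_expansion[OF bounded_linear_D2g, of q w v] by (simp add: D2g_sym[of q w])

lemma Dg_joint_has_derivative:
  "((\<lambda>z. Dg (fst z) (snd z)) has_derivative
     (\<lambda>h. D2g (fst z) (snd z) (fst h) + Dg (fst z) (snd h))) (at z)"
proof -
  have "((\<lambda>z. Dg (fst z) (axis i 1)) has_derivative (\<lambda>h. D2g (fst z) (axis i 1) (fst h))) (at z)" for i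
    by (rule has_derivative_compose[OF has_derivative_fst[OF has_derivative_ident] D2g_has_derivative])
  then have "((\<lambda>z. \<Sum>i\<in>UNIV. snd z $ i *\<^sub>R Dg (fst z) (axis i 1)) has_derivative
     (\<lambda>h. \<Sum>i\<in>UNIV. snd z $ i *\<^sub>R D2g (fst z) (axis i 1) (fst h) + snd h $ i *\<^sub>R Dg (fst z) (axis i 1))) (at z)"
    by (intro has_derivative_sum has_derivative_scaleR
      bounded_linear.has_derivative[OF bounded_linear_vec_nth] has_derivative_snd has_derivative_ident)
  then show ?thesis by (simp add: sum.distrib Dg_expansion[symmetric] D2g_expansion[symmetric])
qed

lemma Jac_apply: "Jac g q *v v = Dg q v"
proof -
  have "(g has_derivative (*v) (Jac g q)) (at q)"
    using differentiableI[OF Dg_has_derivative] by (simp add: jacobian_works)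
  then have "(*v) (Jac g q) = Dg q" using Dg_has_derivative by (rule has_derivative_unique)
  then show ?thesis by simp
qed

lemma inner_transpose_Jac: "w \<bullet> (transpose (Jac g q) *v l) = Dg q w \<bullet> l"
  by (simp add: dot_lmul_matrix inner_commute[of w] inner_commute[of l] Jac_apply)

lemma U_has_derivative: "(U has_derivative (\<lambda>h. h \<bullet> gradU q)) (at q)"
proof -
  have D: "(U has_derivative frechet_derivative U (at q)) (at q)"
    by (rule smooth_has_derivative[OF U_smooth])
  have "frechet_derivative U (at q) h = h \<bullet> gradU q" for h
    using linear_axis_expansion[OF has_derivative_bounded_linear[OF D], of h]
    by (simp add: gradU_def inner_vec_def)
  with D show ?thesis by (metis (no_types, lifting) ext)
qed

lemma grad_H: "grad_q (hamiltonian U) (q, p) = gradU q" "grad_p (hamiltonian U) (q, p) = p"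
  using grad_hamiltonian[OF U_has_derivative] by auto

lemma bundle_iff: "z \<in> cotangent_bundle (hamiltonian U) g \<longleftrightarrow> g (fst z) = 0 \<and> Dg (fst z) (snd z) = 0"
  by (cases z) (simp add: cotangent_bundle_def grad_H Jac_apply)

lemma gradU_has_derivative: "(gradU has_derivative hessU q) (at q)"
  unfolding has_derivative_componentwise_within[of gradU]
  using smooth_has_derivative[OF smooth_frechet_derivative[OF U_smooth]]
  by (auto simp: Basis_vec_def inner_axis gradU_def hessU_def)

lemma hessU_sym: "hessU q v \<bullet> w = v \<bullet> hessU q w"
proof -
  let ?D2 = "\<lambda>u. frechet_derivative (\<lambda>x. frechet_derivative U (at x) u) (at q)"
  have sym: "?D2 u v = ?D2 v u" for u v
    by (rule smooth_second_derivative_symmetric[OF U_smooth])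
  have lin: "bounded_linear (?D2 u)" for u
    by (rule has_derivative_bounded_linear[OF smooth_has_derivative[OF
      smooth_frechet_derivative[OF U_smooth]]])
  have "hessU q v \<bullet> w = ?D2 v w" for v w
    using linear_axis_expansion[OF lin, of v w] by (simp add: hessU_def inner_vec_def sym[of v] mult.commute)
  then show ?thesis using sym by (simp add: inner_commute[of v])
qed

lemma Gram_apply: "Gram q *v l = Dg q (transpose (Jac g q) *v l)"
  by (simp add: Gram_def matrix_vector_mul_assoc[symmetric] Jac_apply)

text \<open>If G G^T l = 0, then pairing with l gives that the squared norm of G^T l is 0, and G^T
  is injective because the rank equals the number of constraints.\<close>

lemma det_Gram_nonzero:
  assumes "g q = 0"
  shows "det (Gram q) \<noteq> 0"
proof -
  have inj: "inj ((*v) (transpose (Jac g q)))"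
    using full_rank[OF assms] by (simp add: full_rank_injective[symmetric] rank_transpose)
  have "l = 0" if "Gram q *v l = 0" for l
  proof -
    let ?w = "transpose (Jac g q) *v l"
    have "?w \<bullet> ?w = Dg q ?w \<bullet> l" by (rule inner_transpose_Jac)
    also have "Dg q ?w = 0" using that by (simp only: Gram_apply)
    finally have "?w = transpose (Jac g q) *v 0" by (simp only: inner_zero_left inner_eq_zero_iff matrix_vector_mult_0_right)
    then show "l = 0" using inj by (metis injD)
  qed
  then have "\<exists>B. B ** Gram q = mat 1" by (simp add: matrix_left_invertible_ker)
  then show ?thesis by (simp add: invertible_det_nz[symmetric] invertible_left_inverse)
qed

lemma bundle_subset_regular: "cotangent_bundle (hamiltonian U) g \<subseteq> regular"
  using det_Gram_nonzero by (auto simp: bundle_iff regular_def)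

text \<open>Both directions matter: uniqueness identifies the multiplier of an arbitrary solution,
  and solvability makes \<open>X\<close> preserve the constraints.\<close>

lemma multiplier_iff:
  "z \<in> regular \<Longrightarrow> Gram (fst z) *v l = rhs z \<longleftrightarrow> l = multiplier z"
  unfolding multiplier_def regular_def by (intro cramer) simp

section \<open>Continuous differentiability of the extended field\<close>

lemma C1_on_smooth_fst: "smooth f \<Longrightarrow> C1_on W (\<lambda>z::(real^'m) \<times> (real^'m). f (fst z))"
  by (rule C1_on_compose_linear[OF smooth_C1_on]) (auto intro: bounded_linear_fst)

lemma C1_on_snd: "C1_on W (snd :: (real^'m) \<times> (real^'m) \<Rightarrow> real^'m)"
  by (rule C1_on_bounded_linear[OF bounded_linear_snd])

lemma C1_on_Gram: "C1_on W (\<lambda>z::(real^'m) \<times> (real^'m). Gram (fst z) $ i $ j)"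
proof -
  have J: "Jac g q $ i $ k = Dg q (axis k 1) $ i" for q i k
    using Jac_apply[of q "axis k 1", symmetric] by (simp add: matrix_vector_mult_basis column_def)
  show ?thesis
    unfolding Gram_def matrix_matrix_mult_def transpose_def
    by (simp add: J) (intro C1_on_sum C1_on_mult C1_on_component C1_on_smooth_fst smooth_Dg)
qed

lemma C1_on_gradU: "C1_on W (\<lambda>z::(real^'m) \<times> (real^'m). gradU (fst z))"
  by (rule C1_on_vec) (simp add: gradU_def, intro C1_on_smooth_fst smooth_frechet_derivative U_smooth)

lemma C1_on_L: "C1_on W f \<Longrightarrow> C1_on W (\<lambda>z. L *v f z)"
  by (rule C1_on_linear_compose[OF _ matrix_vector_mul_bounded_linear])

lemma C1_on_rhs: "C1_on W rhs"
proof -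
  have D2: "D2g q p p = (\<Sum>i\<in>UNIV. \<Sum>j\<in>UNIV. p $ i *\<^sub>R p $ j *\<^sub>R D2g q (axis i 1) (axis j 1))" for q p
    using D2g_expansion[of q p p] linear_axis_expansion[OF bounded_linear_D2g, of q _ p]
    by (simp add: scaleR_sum_right)
  have "rhs = (\<lambda>z. (\<Sum>i\<in>UNIV. \<Sum>j\<in>UNIV. snd z $ i *\<^sub>R snd z $ j *\<^sub>R D2g (fst z) (axis i 1) (axis j 1))
      - (\<Sum>i\<in>UNIV. (gradU (fst z) + L *v snd z) $ i *\<^sub>R Dg (fst z) (axis i 1)))"
    by (intro ext) (simp only: rhs_def D2[symmetric] Dg_expansion[symmetric])
  moreover have "C1_on W \<dots>"
    by (intro C1_on_diff C1_on_sum C1_on_scaleR C1_on_component C1_on_add C1_on_gradU C1_on_L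
      C1_on_snd C1_on_smooth_fst smooth_Dg smooth_D2g)
  ultimately show ?thesis by simp
qed

lemma open_regular: "open regular"
proof -
  have "continuous_on UNIV (\<lambda>z::(real^'m) \<times> (real^'m). det (Gram (fst z)))"
    by (intro C1_on_imp_continuous_on C1_on_det C1_on_Gram)
  then show ?thesis unfolding regular_def by (intro open_Collect_neq continuous_on_const)
qed

lemma C1_on_multiplier: "C1_on regular multiplier"
proof (rule C1_on_vec)
  fix k
  have entry: "C1_on regular (\<lambda>z. if j = k then rhs z $ i else Gram (fst z) $ i $ j)" for i j
    by (cases "j = k") (auto intro!: C1_on_component C1_on_rhs C1_on_Gram)
  show "C1_on regular (\<lambda>z. multiplier z $ k)"
    unfolding multiplier_def vec_lambda_beta
    by (intro C1_on_divide C1_on_det C1_on_Gram) (use entry in \<open>auto simp: regular_def\<close>)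
qed

lemma C1_on_X: "C1_on regular X"
proof -
  have "(transpose (Jac g q) *v l) $ i = Dg q (axis i 1) \<bullet> l" for q l i
    using inner_transpose_Jac[of "axis i 1" q l] by (simp add: inner_axis')
  then have "C1_on regular (\<lambda>z. transpose (Jac g (fst z)) *v multiplier z)"
    by (intro C1_on_vec)
      (simp, intro C1_on_bilinear[OF bounded_bilinear_inner] C1_on_smooth_fst smooth_Dg C1_on_multiplier)
  then show ?thesis
    unfolding X_def[abs_def]
    by (intro C1_on_Pair C1_on_diff C1_on_minus C1_on_gradU C1_on_L C1_on_snd)
qed

section \<open>Infinitesimal invariance of the magnetic form\<close>

lemma L_antisym: "x \<bullet> (L *v y) = - (y \<bullet> (L *v x))"
proof -
  have "x \<bullet> (L *v y) = (transpose L *v x) \<bullet> y" by (simp add: dot_lmul_matrix)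
  also have "transpose L *v x = - (L *v x)"
    unfolding L_skew by (simp add: matrix_vector_mult_def vec_eq_iff sum_negf)
  finally show ?thesis by (simp add: inner_commute[of y])
qed

text \<open>The force enters only through products of \<open>snd (A h)\<close> with
  \<open>fst u\<close> or \<open>fst v\<close>. The L block of the form compensates the magnetic
  force: one pair of terms cancels identically, the other by skewness.\<close>

lemma Omega_mag_infinitesimal:
  assumes z: "z \<in> regular" and A: "(X has_derivative A) (at z)"
    and u: "Dg (fst z) (fst u) = 0" and v: "Dg (fst z) (fst v) = 0"
  shows "Omega_mag L u (A v) + Omega_mag L (A u) v = 0"
proof -
  obtain M where M: "(multiplier has_derivative M) (at z)"
    using C1_on_multiplier z unfolding C1_on_def by blast
  have fst_A: "fst (A h) = snd h" for h
  proof -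
    have "((\<lambda>z. fst (X z)) has_derivative (\<lambda>h. fst (A h))) (at z)" by (rule has_derivative_fst[OF A])
    moreover have "((\<lambda>z. fst (X z)) has_derivative (\<lambda>h. snd h)) (at z)"
      unfolding X_def by (auto intro!: derivative_eq_intros)
    ultimately show ?thesis by (metis has_derivative_unique)
  qed
  \<comment> \<open>Pairing with a fixed \<open>w\<close> before differentiating turns the
    constraint force into \<open>Dg (fst z) w \<bullet> multiplier z\<close>, so that the derivative
    \<open>M\<close> of the multiplier meets only \<open>Dg (fst z) w\<close>, which is 0.\<close>
  have snd_A: "w \<bullet> snd (A h) = - (w \<bullet> hessU (fst z) (fst h)) - w \<bullet> (L *v snd h)
      - D2g (fst z) w (fst h) \<bullet> multiplier z" if w: "Dg (fst z) w = 0" for w h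
  proof -
    have "((\<lambda>z. w \<bullet> snd (X z)) has_derivative (\<lambda>h. w \<bullet> snd (A h))) (at z)"
      by (intro has_derivative_inner_right has_derivative_snd A)
    moreover have "((\<lambda>z. w \<bullet> snd (X z)) has_derivative
      (\<lambda>h. - (w \<bullet> hessU (fst z) (fst h)) - w \<bullet> (L *v snd h)
        - (Dg (fst z) w \<bullet> M h + D2g (fst z) w (fst h) \<bullet> multiplier z))) (at z)"
      unfolding X_def snd_conv inner_diff_right inner_minus_right inner_transpose_Jac
      by (intro has_derivative_diff has_derivative_minus has_derivative_inner has_derivative_inner_right M
          has_derivative_compose[OF has_derivative_fst[OF has_derivative_ident] gradU_has_derivative]
          has_derivative_compose[OF has_derivative_fst[OF has_derivative_ident] D2g_has_derivative]
          bounded_linear.has_derivative[OF matrix_vector_mul_bounded_linear]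
          has_derivative_snd has_derivative_ident)
    ultimately show ?thesis using w by (metis (no_types, lifting) has_derivative_unique add_0 inner_zero_left)
  qed
  show ?thesis
    using snd_A[OF u, of v] snd_A[OF v, of u] hessU_sym[of "fst z" "fst u" "fst v"]
      D2g_sym[of "fst z" "fst u" "fst v"] L_antisym[of "fst u" "snd v"] L_antisym[of "snd u" "fst v"]
    by (simp add: Omega_mag_alt fst_A inner_add_right inner_commute)
qed

section \<open>Solutions of the constrained system as integral curves of the extended field\<close>

abbreviation TM :: "((real^'m) \<times> (real^'m)) set" where
  "TM \<equiv> cotangent_bundle (hamiltonian U) g"

text \<open>No regularity of \<open>lam\<close> is available, and none is needed: the first
  derivative of the constraint does not contain it, and in the second it occurs algebraically, never
  differentiated.\<close>

lemma mag_solution_X: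
  assumes I: "open I" and sol: "mag_solution (hamiltonian U) g L I q p" and t: "t \<in> I"
  shows "(q t, p t) \<in> TM"
    and "((\<lambda>t. (q t, p t)) has_vector_derivative X (q t, p t)) (at t)"
proof -
  obtain lam where lam: "\<And>t. t \<in> I \<Longrightarrow> (q has_vector_derivative p t) (at t)"
    "\<And>t. t \<in> I \<Longrightarrow> (p has_vector_derivative
        - gradU (q t) - L *v p t - transpose (Jac g (q t)) *v lam (q t, p t)) (at t)"
    "\<And>t. t \<in> I \<Longrightarrow> g (q t) = 0"
    using sol unfolding mag_solution_def grad_H by blast
  have zero: "d = 0" if "(f has_vector_derivative d) (at t)" "t \<in> I" "\<And>t. t \<in> I \<Longrightarrow> f t = 0"
    for f :: "real \<Rightarrow> real^'k" and d t
  proof -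
    have "((\<lambda>_. 0) has_vector_derivative d) (at t)"
      using that by (intro has_vector_derivative_transform_within_open[OF that(1) I]) auto
    then show ?thesis using has_vector_derivative_const vector_derivative_unique_at by blast
  qed
  have Dgp: "Dg (q t) (p t) = 0" if t: "t \<in> I" for t
  proof (rule zero[OF _ t])
    show "((\<lambda>t. g (q t)) has_vector_derivative Dg (q t) (p t)) (at t)"
      using vector_derivative_diff_chain_within[OF lam(1)[OF t] has_derivative_at_withinI[OF Dg_has_derivative]]
      by (simp add: o_def)
  qed (rule lam(3))
  show TM: "(q t, p t) \<in> TM" using Dgp[OF t] lam(3)[OF t] by (simp add: bundle_iff)
  let ?p' = "- gradU (q t) - L *v p t - transpose (Jac g (q t)) *v lam (q t, p t)"
  have qp: "((\<lambda>t. (q t, p t)) has_vector_derivative (p t, ?p')) (at t)"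
    by (intro has_vector_derivative_Pair lam t)
  have "D2g (q t) (p t) (p t) + Dg (q t) ?p' = 0"
  proof (rule zero[OF _ t])
    show "((\<lambda>t. Dg (q t) (p t)) has_vector_derivative D2g (q t) (p t) (p t) + Dg (q t) ?p') (at t)"
      using vector_derivative_diff_chain_within[OF qp has_derivative_at_withinI[OF Dg_joint_has_derivative]]
      by (simp add: o_def)
  qed (rule Dgp)
  then have "Gram (q t) *v lam (q t, p t) = rhs (q t, p t)"
    unfolding Gram_apply rhs_def
    by (simp add: linear_diff linear_add linear_neg bounded_linear.linear[OF bounded_linear_Dg] algebra_simps
        del: transpose_matrix_vector)
  then have "lam (q t, p t) = multiplier (q t, p t)"
    using multiplier_iff[of "(q t, p t)"] TM bundle_subset_regular by auto
  then show "((\<lambda>t. (q t, p t)) has_vector_derivative X (q t, p t)) (at t)"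
    using qp by (simp add: X_def)
qed

text \<open>By the choice of the multiplier, \<open>Dg q p\<close> has zero derivative along
  \<open>X\<close> everywhere on \<open>regular\<close>, even off the bundle. It therefore stays 0
  once it starts there, and only then does g(q), whose derivative it is, stay 0 as well.\<close>

lemma bundle_invariant:
  assumes ab: "a \<le> 0" "0 \<le> b" and x0: "x 0 \<in> TM"
    and x: "\<And>s. s \<in> {a..b} \<Longrightarrow> (x has_vector_derivative X (x s)) (at s within {a..b})"
      "\<And>s. s \<in> {a..b} \<Longrightarrow> x s \<in> regular"
    and s: "s \<in> {a..b}"
  shows "x s \<in> TM"
proof -
  have const: "f s = 0" if "\<And>s. s \<in> {a..b} \<Longrightarrow> (f has_vector_derivative 0) (at s within {a..b})"
    "f 0 = 0" "s \<in> {a..b}" for f :: "real \<Rightarrow> real^'k" and s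
    using zero_vector_derivative_eq[OF that(1) that(3), of 0] that(2) ab by simp
  have velocity: "Dg (fst (x s)) (snd (x s)) = 0" if s: "s \<in> {a..b}" for s
  proof (rule const[OF _ _ s])
    fix s assume s: "s \<in> {a..b}"
    have "((\<lambda>s. Dg (fst (x s)) (snd (x s))) has_vector_derivative
        D2g (fst (x s)) (snd (x s)) (fst (X (x s))) + Dg (fst (x s)) (snd (X (x s)))) (at s within {a..b})"
      using vector_derivative_diff_chain_within[OF x(1)[OF s] has_derivative_at_withinI[OF Dg_joint_has_derivative]]
      by (simp add: o_def)
    also have "D2g (fst (x s)) (snd (x s)) (fst (X (x s))) + Dg (fst (x s)) (snd (X (x s)))
        = rhs (x s) - Gram (fst (x s)) *v multiplier (x s)"
      unfolding Gram_apply rhs_def X_def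
      by (simp add: linear_diff linear_add linear_neg bounded_linear.linear[OF bounded_linear_Dg] algebra_simps
          del: transpose_matrix_vector)
    also have "\<dots> = 0" using multiplier_iff[OF x(2)[OF s], of "multiplier (x s)"] by simp
    finally show "((\<lambda>s. Dg (fst (x s)) (snd (x s))) has_vector_derivative 0) (at s within {a..b})" .
  qed (use x0 in \<open>simp add: bundle_iff\<close>)
  have "g (fst (x s)) = 0"
  proof (rule const[OF _ _ s])
    fix s assume s: "s \<in> {a..b}"
    have "((\<lambda>s. fst (x s)) has_vector_derivative fst (X (x s))) (at s within {a..b})"
      by (rule bounded_linear.has_vector_derivative[OF bounded_linear_fst x(1)[OF s]])
    from vector_derivative_diff_chain_within[OF this has_derivative_at_withinI[OF Dg_has_derivative]]
    show "((\<lambda>s. g (fst (x s))) has_vector_derivative 0) (at s within {a..b})"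
      using velocity[OF s] by (simp add: o_def X_def)
  qed (use x0 in \<open>simp add: bundle_iff\<close>)
  then show ?thesis using velocity[OF s] by (simp add: bundle_iff)
qed

section \<open>The flow as a well-defined partial map\<close>

abbreviation reaches where "reaches \<equiv> mag_reaches (hamiltonian U) g L"
abbreviation flow where "flow \<equiv> mag_flow (hamiltonian U) g L"
abbreviation flow_dom where "flow_dom \<equiv> mag_flow_dom (hamiltonian U) g L"

text \<open>Shrinks the open interval of existence to a compact one with 0 and t in its interior, as
  the compactness arguments require, while derivatives stay two-sided up to the endpoints.\<close>

lemma reachesE:
  assumes "reaches t z w"
  obtains a b x where "a < 0" "0 < b" "a < t" "t < b" "x 0 = z" "x t = w"
    "\<forall>s\<in>{a..b}. x s \<in> TM"
    "\<forall>s\<in>{a..b}. (x has_vector_derivative X (x s)) (at s)"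
proof -
  obtain I q p where I: "open I" "is_interval I" "0 \<in> I" "t \<in> I"
    and sol: "mag_solution (hamiltonian U) g L I q p" and x: "(q 0, p 0) = z" "(q t, p t) = w"
    using assms unfolding mag_reaches_def by blast
  obtain e where e: "e > 0" "ball 0 e \<subseteq> I" using I openE by metis
  obtain d where d: "d > 0" "ball t d \<subseteq> I" using I openE by metis
  define r where "r = min e d / 2"
  have r: "r > 0" "r < e" "r < d" using e d by (auto simp: r_def)
  have "min 0 t - r \<in> I" "max 0 t + r \<in> I"
    using e d r by (auto simp: min_def max_def subset_iff dist_real_def)
  then have sub: "{min 0 t - r..max 0 t + r} \<subseteq> I"
    using I(2) unfolding is_interval_1 by (meson atLeastAtMost_iff subsetI)
  show thesis
  proof (rule that[of "min 0 t - r" "max 0 t + r" "\<lambda>s. (q s, p s)"])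
    show "\<forall>s\<in>{min 0 t - r..max 0 t + r}. (q s, p s) \<in> TM"
      "\<forall>s\<in>{min 0 t - r..max 0 t + r}.
        ((\<lambda>s. (q s, p s)) has_vector_derivative X (q s, p s)) (at s)"
      using mag_solution_X[OF I(1) sol subsetD[OF sub]] by simp_all
  qed (use r x in auto)
qed

lemma reachesI:
  assumes t: "a < 0" "0 < b" "a < t" "t < b" and x: "x 0 = z" "x t = w"
    "\<And>s. s \<in> {a<..<b} \<Longrightarrow> x s \<in> TM"
    "\<And>s. s \<in> {a<..<b} \<Longrightarrow> (x has_vector_derivative X (x s)) (at s)"
  shows "reaches t z w"
  unfolding mag_reaches_def
proof (intro exI conjI)
  show "open {a<..<b}" "is_interval {a<..<b}" "0 \<in> {a<..<b}" "t \<in> {a<..<b}"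
    using t by (auto simp: is_interval_1)
  show "(fst (x 0), snd (x 0)) = z" "(fst (x t), snd (x t)) = w" using x by auto
  show "mag_solution (hamiltonian U) g L {a<..<b} (\<lambda>s. fst (x s)) (\<lambda>s. snd (x s))"
    unfolding mag_solution_def grad_H
  proof (intro exI[of _ multiplier] ballI conjI)
    fix s assume s: "s \<in> {a<..<b}"
    show "g (fst (x s)) = 0" using x(3)[OF s] by (simp add: bundle_iff)
    show "((\<lambda>s. fst (x s)) has_vector_derivative snd (x s)) (at s)"
      using bounded_linear.has_vector_derivative[OF bounded_linear_fst x(4)[OF s]] by (simp add: X_def)
    show "((\<lambda>s. snd (x s)) has_vector_derivative - gradU (fst (x s)) - L *v snd (x s)
        - transpose (Jac g (fst (x s))) *v multiplier (fst (x s), snd (x s))) (at s)"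
      using bounded_linear.has_vector_derivative[OF bounded_linear_snd x(4)[OF s]]
      by (simp add: X_def del: transpose_matrix_vector)
  qed
qed

lemma X_blinfun_derivative:
  obtains X' where "\<And>x. x \<in> regular \<Longrightarrow> (X has_derivative blinfun_apply (X' x)) (at x)"
    "continuous_on regular X'"
  using C1_on_blinfunE[OF C1_on_X] by metis

lemma reference_solutionI:
  assumes "a \<le> 0" "0 \<le> b"
    and "\<And>s. s \<in> {a..b} \<Longrightarrow> x s \<in> TM"
    and "\<And>s. s \<in> {a..b} \<Longrightarrow> (x has_vector_derivative X (x s)) (at s)"
    and "\<And>x. x \<in> regular \<Longrightarrow> (X has_derivative blinfun_apply (X' x)) (at x)"
    "continuous_on regular X'"
  shows "reference_solution X X' regular a b x"
proof
  fix s assume s: "s \<in> {a..b}"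
  show "(x has_vector_derivative X (x s)) (at s within {a..b})"
    by (rule has_vector_derivative_at_within[OF assms(4)[OF s]])
  show "x s \<in> regular" using assms(3)[OF s] bundle_subset_regular by blast
qed (fact open_regular assms)+

text \<open>Justifies the definite description in \<open>mag_flow\<close>. The two solutions may
  live on different intervals; they are compared on the intersection, which still contains 0 and
  t.\<close>

lemma reaches_unique:
  assumes "reaches t z w" "reaches t z w'"
  shows "w = w'"
proof -
  obtain a b x where x: "a < 0" "0 < b" "a < t" "t < b" "x 0 = z" "x t = w"
    "\<forall>s\<in>{a..b}. x s \<in> TM"
    "\<forall>s\<in>{a..b}. (x has_vector_derivative X (x s)) (at s)"
    by (rule reachesE[OF assms(1)])
  obtain c d y where y: "c < 0" "0 < d" "c < t" "t < d" "y 0 = z" "y t = w'"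
    "\<forall>s\<in>{c..d}. y s \<in> TM"
    "\<forall>s\<in>{c..d}. (y has_vector_derivative X (y s)) (at s)"
    by (rule reachesE[OF assms(2)])
  obtain X' where X': "\<And>x. x \<in> regular \<Longrightarrow> (X has_derivative blinfun_apply (X' x)) (at x)"
    "continuous_on regular X'" using X_blinfun_derivative by metis
  interpret reference_solution X X' regular "max a c" "min b d" x
    using x y by (intro reference_solutionI X') auto
  have "y t = x t"
  proof (rule solution_unique)
    fix s assume "s \<in> {max a c..min b d}"
    then have s: "s \<in> {c..d}" by simp
    show "(y has_vector_derivative X (y s)) (at s within {max a c..min b d})"
      by (rule has_vector_derivative_at_within[OF bspec[OF y(8) s]])
    show "y s \<in> regular" using bspec[OF y(7) s] bundle_subset_regular by blast
  qed (use x y in auto)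
  then show ?thesis using x y by simp
qed

lemma flow_eq: "reaches t z w \<Longrightarrow> flow t z = w"
  unfolding mag_flow_def using reaches_unique by (intro the_equality)

lemma reaches_flow: "z \<in> flow_dom t \<Longrightarrow> reaches t z (flow t z)"
  unfolding mag_flow_dom_def using flow_eq[of t z] by fastforce

text \<open>The field does not depend on time, so the solution shifted by t is again a solution; it
  starts at \<open>w\<close> and is at \<open>z\<close> at time -t.\<close>

lemma reaches_reverse:
  assumes "reaches t z w"
  shows "reaches (- t) w z"
proof -
  obtain a b x where x: "a < 0" "0 < b" "a < t" "t < b" "x 0 = z" "x t = w"
    "\<forall>s\<in>{a..b}. x s \<in> TM"
    "\<forall>s\<in>{a..b}. (x has_vector_derivative X (x s)) (at s)"
    by (rule reachesE[OF assms])
  show ?thesis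
  proof (rule reachesI[where a = "a - t" and b = "b - t" and x = "\<lambda>s. x (s + t)"])
    fix s assume s: "s \<in> {a - t<..<b - t}"
    then have s': "s + t \<in> {a..b}" by auto
    show "x (s + t) \<in> TM" by (rule bspec[OF x(7) s'])
    have "((\<lambda>s. s + t) has_vector_derivative 1) (at s)" by (auto intro!: derivative_eq_intros)
    from vector_diff_chain_at[OF this bspec[OF x(8) s']]
    show "((\<lambda>s. x (s + t)) has_vector_derivative X (x (s + t))) (at s)" by (simp add: o_def)
  qed (use x in auto)
qed

lemma reaches_in_bundle:
  assumes "reaches t z w"
  shows "z \<in> TM"
proof -
  obtain a b x where x: "a < 0" "0 < b" "a < t" "t < b" "x 0 = z" "x t = w"
    "\<forall>s\<in>{a..b}. x s \<in> TM"
    "\<forall>s\<in>{a..b}. (x has_vector_derivative X (x s)) (at s)"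
    by (rule reachesE[OF assms])
  show ?thesis using bspec[OF x(7), of 0] x by simp
qed

section \<open>Reversibility, conservation of energy and symplecticity\<close>

lemma flow_symmetric:
  assumes "z \<in> flow_dom t"
  shows "flow t z \<in> flow_dom (- t)" and "flow (- t) (flow t z) = z"
proof -
  have r: "reaches (- t) (flow t z) z" by (rule reaches_reverse[OF reaches_flow[OF assms]])
  then show "flow (- t) (flow t z) = z" by (rule flow_eq)
  show "flow t z \<in> flow_dom (- t)"
    using r reaches_in_bundle[OF r] unfolding mag_flow_dom_def by blast
qed

lemma flow_conserves_hamiltonian:
  assumes "z \<in> flow_dom t"
  shows "hamiltonian U (flow t z) = hamiltonian U z"
proof -
  obtain a b x where x: "a < 0" "0 < b" "a < t" "t < b" "x 0 = z" "x t = flow t z"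
    "\<forall>s\<in>{a..b}. x s \<in> TM"
    "\<forall>s\<in>{a..b}. (x has_vector_derivative X (x s)) (at s)"
    by (rule reachesE[OF reaches_flow[OF assms]])
  have "((\<lambda>s. hamiltonian U (x s)) has_vector_derivative 0) (at s within {a..b})"
    if s: "s \<in> {a..b}" for s
  proof -
    let ?q = "fst (x s)" and ?p = "snd (x s)"
    let ?J = "transpose (Jac g ?q) *v multiplier (x s)"
    have "(hamiltonian U has_derivative
        (\<lambda>h. fst h \<bullet> gradU ?q + 1 / 2 * (?p \<bullet> snd h + snd h \<bullet> ?p))) (at (x s))"
      unfolding hamiltonian_def split_beta
      by (intro has_derivative_add has_derivative_mult_right has_derivative_inner has_derivative_snd
        has_derivative_ident
        has_derivative_compose[OF has_derivative_fst[OF has_derivative_ident] U_has_derivative])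
    from vector_derivative_diff_chain_within[OF has_vector_derivative_at_within[OF bspec[OF x(8) s]]
        has_derivative_at_withinI[OF this]]
    have "((\<lambda>s. hamiltonian U (x s)) has_vector_derivative
        fst (X (x s)) \<bullet> gradU ?q + 1 / 2 * (?p \<bullet> snd (X (x s)) + snd (X (x s)) \<bullet> ?p)) (at s within {a..b})"
      by (simp add: o_def)
    also have "fst (X (x s)) \<bullet> gradU ?q + 1 / 2 * (?p \<bullet> snd (X (x s)) + snd (X (x s)) \<bullet> ?p)
        = ?p \<bullet> gradU ?q + ?p \<bullet> snd (X (x s))"
      by (simp add: X_def inner_commute)
    also have "\<dots> = - (?p \<bullet> (L *v ?p)) - ?p \<bullet> ?J"
      unfolding X_def snd_conv inner_diff_right inner_minus_right by simp
    also have "?p \<bullet> ?J = 0"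
      using bspec[OF x(7) s] unfolding inner_transpose_Jac by (simp add: bundle_iff)
    finally show ?thesis using L_antisym[of ?p ?p] by simp
  qed
  from zero_vector_derivative_eq[OF this, of t 0] show ?thesis using x by simp
qed

text \<open>Near \<open>z\<close> within the bundle, the flow coincides with a family of solutions
  of the extended equation on one common interval; this also shows that those points belong to the
  flow domain. The derivative of the family is thus a derivative of the flow within the
  bundle.\<close>

lemma flow_symplectic:
  assumes "z \<in> flow_dom t"
  shows "flow t differentiable (at z within TM)"
    and "u \<in> tangent_space TM z \<Longrightarrow> v \<in> tangent_space TM z \<Longrightarrow>
      pullback_form TM (flow t) (Omega_mag L) z u v = Omega_mag L u v"
proof -
  obtain a b x where t: "a < 0" "0 < b" "a < t" "t < b" and "x 0 = z" "x t = flow t z"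
    and "\<forall>s\<in>{a..b}. x s \<in> TM" "\<forall>s\<in>{a..b}. (x has_vector_derivative X (x s)) (at s)"
    by (rule reachesE[OF reaches_flow[OF assms]])
  then have x: "x 0 = z" "\<And>s. s \<in> {a..b} \<Longrightarrow> x s \<in> TM"
    "\<And>s. s \<in> {a..b} \<Longrightarrow> (x has_vector_derivative X (x s)) (at s)" by auto
  have z: "z \<in> TM" using x(2)[of 0] t x(1) by auto
  obtain X' where X': "\<And>x. x \<in> regular \<Longrightarrow> (X has_derivative blinfun_apply (X' x)) (at x)"
    "continuous_on regular X'" using X_blinfun_derivative by metis
  interpret reference_solution X X' regular a b x
    using t x by (intro reference_solutionI X') auto
  obtain r c where r: "r > 0" "c > 0" and near: "\<And>y. y \<in> ball z r \<Longrightarrow> \<exists>w. w 0 = y \<and> (\<forall>s\<in>{a..b}.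
       (w has_vector_derivative X (w s)) (at s within {a..b}) \<and> w s \<in> regular \<and>
       norm (w s - x s) \<le> c * norm (y - z))"
    using nearby_solutions unfolding x(1) by metis
  then obtain \<phi> where \<phi>: "\<And>y. y \<in> ball z r \<Longrightarrow> \<phi> y 0 = y"
    "\<And>y s. y \<in> ball z r \<Longrightarrow> s \<in> {a..b} \<Longrightarrow> (\<phi> y has_vector_derivative X (\<phi> y s)) (at s within {a..b})"
    "\<And>y s. y \<in> ball z r \<Longrightarrow> s \<in> {a..b} \<Longrightarrow> \<phi> y s \<in> regular"
    "\<And>y s. y \<in> ball z r \<Longrightarrow> s \<in> {a..b} \<Longrightarrow> norm (\<phi> y s - x s) \<le> c * norm (y - z)"
    by metis
  have \<phi>_TM: "\<phi> y s \<in> TM" if "y \<in> TM" "y \<in> ball z r" "s \<in> {a..b}" for y s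
    using that t \<phi> by (intro bundle_invariant[of a b "\<phi> y" s]) auto
  have \<phi>_flow: "\<phi> y t = flow t y" if y: "y \<in> TM" "y \<in> ball z r" for y
  proof -
    have "reaches t y (\<phi> y t)"
    proof (rule reachesI[where x = "\<phi> y", OF t])
      fix s assume s: "s \<in> {a<..<b}"
      then show "\<phi> y s \<in> TM" by (intro \<phi>_TM y) auto
      show "(\<phi> y has_vector_derivative X (\<phi> y s)) (at s)"
        using \<phi>(2)[OF y(2), of s] s by (simp add: at_within_Icc_at)
    qed (use \<phi>(1) y in auto)
    then show ?thesis by (simp add: flow_eq)
  qed
  obtain \<eta> where "\<forall>v. \<eta> v 0 = v"
    "\<forall>v. \<forall>s\<in>{a..b}. (\<eta> v has_vector_derivative X' (x s) (\<eta> v s)) (at s within {a..b})"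
    "\<forall>s\<in>{a..b}. bounded_linear (\<lambda>v. \<eta> v s)"
    by (rule variational_solution)
  then have \<eta>: "\<And>v. \<eta> v 0 = v"
    "\<And>v s. s \<in> {a..b} \<Longrightarrow> (\<eta> v has_vector_derivative X' (x s) (\<eta> v s)) (at s within {a..b})"
    "\<And>s. s \<in> {a..b} \<Longrightarrow> bounded_linear (\<lambda>v. \<eta> v s)"
    by blast+
  have D\<phi>: "((\<lambda>y. \<phi> y s) has_derivative (\<lambda>v. \<eta> v s)) (at z within TM)" if "s \<in> {a..b}" for s
    using flow_has_derivative[OF \<eta> r, where S = TM and \<phi> = \<phi> and s = s] \<phi> that z
    unfolding x(1) by blast
  \<comment> \<open>The constraint vanishes along all nearby solutions starting in the bundle, so
    its composite with the flow has the zero map as a derivative within \<open>TM\<close>. The chain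
    rule gives another derivative, and the two agree on tangent vectors.\<close>
  have tan: "Dg (fst (x s)) (fst (\<eta> u s)) = 0"
    if u: "u \<in> tangent_space TM z" and s: "s \<in> {a..b}" for u s
  proof -
    have \<phi>z: "\<phi> z s = x s" using \<phi>(4)[of z s] s r by simp
    have "((\<lambda>y. g (fst (\<phi> y s))) has_derivative (\<lambda>h. Dg (fst (x s)) (fst (\<eta> h s)))) (at z within TM)"
      using has_derivative_compose[OF has_derivative_fst[OF D\<phi>[OF s]] Dg_has_derivative]
      by (simp add: \<phi>z)
    moreover have "((\<lambda>y. g (fst (\<phi> y s))) has_derivative (\<lambda>h. 0)) (at z within TM)"
      by (rule has_derivative_transform_within[OF has_derivative_const r(1) z])
        (use \<phi>_TM s in \<open>simp add: bundle_iff dist_commute\<close>)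
    ultimately show ?thesis using has_derivative_tangent_unique u by blast
  qed
  have D: "(flow t has_derivative (\<lambda>v. \<eta> v t)) (at z within TM)"
    using t by (intro has_derivative_transform_within[OF D\<phi>[of t] r(1) z])
      (auto simp: \<phi>_flow dist_commute)
  then show diff: "flow t differentiable (at z within TM)" by (rule differentiableI)
  assume u: "u \<in> tangent_space TM z" and v: "v \<in> tangent_space TM z"
  have "((\<lambda>s. Omega_mag L (\<eta> u s) (\<eta> v s)) has_vector_derivative 0) (at s within {a..b})"
    if s: "s \<in> {a..b}" for s
  proof -
    have reg: "x s \<in> regular" using x(2)[OF s] bundle_subset_regular by blast
    show ?thesis
      using bounded_bilinear.has_vector_derivative[OF bounded_bilinear_Omega_mag \<eta>(2)[OF s, of u] \<eta>(2)[OF s, of v], of L]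
        Omega_mag_infinitesimal[OF reg X'(1)[OF reg] tan[OF u s] tan[OF v s]] by simp
  qed
  from zero_vector_derivative_eq[OF this, of t 0]
  have "Omega_mag L (\<eta> u t) (\<eta> v t) = Omega_mag L u v" using t by (simp add: \<eta>(1))
  \<comment> \<open>\<open>frechet_derivative\<close> within \<open>TM\<close> is only some
    derivative; agreement with \<open>\<eta>\<close> is claimed for tangent vectors alone.\<close>
  moreover have "frechet_derivative (flow t) (at z within TM) w = \<eta> w t" if "w \<in> tangent_space TM z" for w
    using diff D that unfolding frechet_derivative_works by (rule has_derivative_tangent_unique)
  ultimately show "pullback_form TM (flow t) (Omega_mag L) z u v = Omega_mag L u v"
    using u v by (simp add: pullback_form_def)
qed

end

theorem theorem2:
  fixes g :: "real^'m \<Rightarrow> real^'k"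
    and U :: "real^'m \<Rightarrow> real"
    and L :: "real^'m^'m"
  assumes "smooth g"
    and "connected {q. g q = 0}"
    and "\<forall>q. g q = 0 \<longrightarrow> rank (Jac g q) = CARD('k)"
    and "smooth U"
    and "transpose L = - L"
  shows "(\<forall>t. \<forall>z \<in> mag_flow_dom (hamiltonian U) g L t.
            mag_flow (hamiltonian U) g L t z \<in> mag_flow_dom (hamiltonian U) g L (- t) \<and>
            mag_flow (hamiltonian U) g L (- t) (mag_flow (hamiltonian U) g L t z) = z) \<and>
         (\<forall>t. \<forall>z \<in> mag_flow_dom (hamiltonian U) g L t.
            mag_flow (hamiltonian U) g L t differentiable
              (at z within cotangent_bundle (hamiltonian U) g) \<and>
            (\<forall>u \<in> tangent_space (cotangent_bundle (hamiltonian U) g) z.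
             \<forall>v \<in> tangent_space (cotangent_bundle (hamiltonian U) g) z.
               pullback_form (cotangent_bundle (hamiltonian U) g) (mag_flow (hamiltonian U) g L t)
                 (Omega_mag L) z u v = Omega_mag L u v)) \<and>
         (\<forall>t. \<forall>z \<in> mag_flow_dom (hamiltonian U) g L t.
            hamiltonian U (mag_flow (hamiltonian U) g L t z) = hamiltonian U z)"
proof -
  interpret constrained_magnetic g U L
    using assms by unfold_locales auto
  show ?thesis
    by (intro conjI allI ballI flow_symmetric flow_symplectic flow_conserves_hamiltonian)
qed

end
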